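(* Let $\Omega$, $B$, $\phi$, $\epsilon>0$, $D$, $d$, $b$ and $m$ be as in the context; in particular $m-\frac12\nabla\cdot b\ge 0$. Consider the bilinear form on $H^1_0(B)$ $$a(u,v) := \int_B \phi D\,\nabla u\cdot\nabla v+\frac{D}{\epsilon^{3}}(1-\phi)\,uv+\phi\,(b\cdot\nabla u)\,v+[b\cdot\nabla\phi]^{+}\,uv+\phi m\,uv\;dx .$$ Then $a$ is coercive: there is a constant $C>0$ such that $a(u,u)\ge C\|u\|^2$ for all $u\in H^1_0(B)$, with respect to the norm $$\|u\|^2 := \int_B \phi|\nabla u|^2+\epsilon^{-3}(1-\phi)|u|^2\;dx .$$
   Context: $\Omega\subset\mathbb{R}^n$ is a sufficiently smooth bounded domain, and $B\supset\Omega$ is a larger bounded domain. $r$ is the signed distance function of $\Omega$ (negative in $\Omega$, positive outside, $|\nabla r|=1$ almost everywhere). For a fixed parameter $\epsilon>0$ the phase-field function is $$\phi(x)=\tfrac12\left(1-\tanh\left(\tfrac{3r(x)}{\epsilon}\right)\right),\quad x\in B,$$ so $\phi$ takes values in $(0,1)$ and $\nabla\phi=-\frac{6}{\epsilon}\phi(1-\phi)\nabla r$. $D:B\to\mathbb{R}$ is a bounded scalar function with $D(x)\ge d>0$ for a constant $d$. $b:B\to\mathbb{R}^n$ is a given velocity field with $b\in W^{1,\infty}(B)^n$ and $m\in L^\infty(B)$ is a given scalar function, satisfying $m-\frac12\nabla\cdot b\ge0$ in $B$. Notation: $[w]^+=\max(w,0)$. *)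

theory Defs
  imports "HOL-Analysis.Analysis"
begin

section \<open>Smooth functions and smooth domains\<close>

text \<open>\<open>Ck_on k S f\<close> is meant for open \<open>S\<close> and says that \<open>f\<close> is of class \<open>C\<^sup>k\<close> on \<open>S\<close>.\<close>

primrec Ck_on :: "nat \<Rightarrow> 'a::euclidean_space set \<Rightarrow> ('a \<Rightarrow> real) \<Rightarrow> bool" where
  "Ck_on 0 S f \<longleftrightarrow> continuous_on S f"
| "Ck_on (Suc k) S f \<longleftrightarrow>
     (\<forall>x\<in>S. f differentiable (at x)) \<and>
     (\<forall>i\<in>Basis. Ck_on k S (\<lambda>x. frechet_derivative f (at x) i))"

definition bounded_domain :: "'a::euclidean_space set \<Rightarrow> bool" where
  "bounded_domain S \<longleftrightarrow> open S \<and> connected S \<and> bounded S \<and> S \<noteq> {}"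

text \<open>Boundary of class \<open>C\<^sup>k\<close> (for \<open>k \<ge> 1\<close>), in terms of local defining functions with
  non-vanishing gradient.\<close>

definition Ck_boundary :: "nat \<Rightarrow> 'a::euclidean_space set \<Rightarrow> bool" where
  "Ck_boundary k S \<longleftrightarrow>
     (\<forall>p\<in>frontier S. \<exists>U \<rho>. open U \<and> p \<in> U \<and> Ck_on k U \<rho> \<and>
        (\<forall>x\<in>U. \<exists>i\<in>Basis. frechet_derivative \<rho> (at x) i \<noteq> 0) \<and>
        S \<inter> U = {x\<in>U. \<rho> x < 0})"

definition test_function :: "'a::euclidean_space set \<Rightarrow> ('a \<Rightarrow> real) \<Rightarrow> bool" where
  "test_function B \<psi> \<longleftrightarrow>
     (\<forall>k. Ck_on k UNIV \<psi>) \<and>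
     compact (closure {x. \<psi> x \<noteq> 0}) \<and> closure {x. \<psi> x \<noteq> 0} \<subseteq> B"

section \<open>Weak derivatives and Sobolev spaces\<close>

text \<open>Elements of the Lebesgue and Sobolev spaces on an open set \<open>B\<close> are represented by functions
  on the whole space, of which only the values on \<open>B\<close> matter; they are not quotiented by equality
  almost everywhere.\<close>

definition locally_integrable :: "'a::euclidean_space set \<Rightarrow> ('a \<Rightarrow> real) \<Rightarrow> bool" where
  "locally_integrable B f \<longleftrightarrow>
     (\<forall>K. compact K \<and> K \<subseteq> B \<longrightarrow> integrable (lebesgue_on K) f)"

definition has_weak_pderiv ::
    "'a::euclidean_space set \<Rightarrow> 'a \<Rightarrow> ('a \<Rightarrow> real) \<Rightarrow> ('a \<Rightarrow> real) \<Rightarrow> bool" where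
  "has_weak_pderiv B i f g \<longleftrightarrow>
     locally_integrable B f \<and> locally_integrable B g \<and>
     (\<forall>\<psi>. test_function B \<psi> \<longrightarrow>
        (LINT x|lebesgue_on B. f x * frechet_derivative \<psi> (at x) i) =
        - (LINT x|lebesgue_on B. g x * \<psi> x))"

text \<open>Some representative of the weak partial derivative, which is unique almost everywhere on \<open>B\<close>
  when it exists, and unspecified otherwise.\<close>

definition weak_pderiv :: "'a::euclidean_space set \<Rightarrow> 'a \<Rightarrow> ('a \<Rightarrow> real) \<Rightarrow> 'a \<Rightarrow> real" where
  "weak_pderiv B i f = (SOME g. has_weak_pderiv B i f g)"

definition weak_grad :: "'a::euclidean_space set \<Rightarrow> ('a \<Rightarrow> real) \<Rightarrow> 'a \<Rightarrow> 'a" where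
  "weak_grad B f x = (\<Sum>i\<in>Basis. weak_pderiv B i f x *\<^sub>R i)"

definition weak_div :: "'a::euclidean_space set \<Rightarrow> ('a \<Rightarrow> 'a) \<Rightarrow> 'a \<Rightarrow> real" where
  "weak_div B b x = (\<Sum>i\<in>Basis. weak_pderiv B i (\<lambda>y. b y \<bullet> i) x)"

definition L2 :: "'a::euclidean_space set \<Rightarrow> ('a \<Rightarrow> real) set" where
  "L2 B = {f. f \<in> borel_measurable (lebesgue_on B) \<and>
              integrable (lebesgue_on B) (\<lambda>x. (f x)\<^sup>2)}"

definition Linf :: "'a::euclidean_space set \<Rightarrow> ('a \<Rightarrow> real) set" where
  "Linf B = {f. f \<in> borel_measurable (lebesgue_on B) \<and>
                (\<exists>M. AE x in lebesgue_on B. \<bar>f x\<bar> \<le> M)}"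

definition W1inf :: "'a::euclidean_space set \<Rightarrow> ('a \<Rightarrow> real) set" where
  "W1inf B = {f. f \<in> Linf B \<and> (\<forall>i\<in>Basis. \<exists>g\<in>Linf B. has_weak_pderiv B i f g)}"

definition H1 :: "'a::euclidean_space set \<Rightarrow> ('a \<Rightarrow> real) set" where
  "H1 B = {f. f \<in> L2 B \<and> (\<forall>i\<in>Basis. \<exists>g\<in>L2 B. has_weak_pderiv B i f g)}"

definition H1_norm :: "'a::euclidean_space set \<Rightarrow> ('a \<Rightarrow> real) \<Rightarrow> real" where
  "H1_norm B f = sqrt (LINT x|lebesgue_on B. (f x)\<^sup>2 + (norm (weak_grad B f x))\<^sup>2)"

text \<open>The closure of the test functions in \<open>H\<^sup>1(B)\<close>.\<close>

definition H10 :: "'a::euclidean_space set \<Rightarrow> ('a \<Rightarrow> real) set" where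
  "H10 B = {f. f \<in> H1 B \<and>
     (\<exists>\<psi>. (\<forall>k. test_function B (\<psi> k)) \<and>
          (\<lambda>k::nat. H1_norm B (\<lambda>x. f x - \<psi> k x)) \<longlonglongrightarrow> 0)}"

section \<open>The phase-field problem\<close>

definition signed_dist :: "'a::euclidean_space set \<Rightarrow> 'a \<Rightarrow> real" where
  "signed_dist S x = (if x \<in> S then - infdist x (frontier S) else infdist x (frontier S))"

definition phase_field :: "real \<Rightarrow> 'a::euclidean_space set \<Rightarrow> 'a \<Rightarrow> real" where
  "phase_field \<epsilon> S x = 1 / 2 * (1 - tanh (3 * signed_dist S x / \<epsilon>))"

text \<open>The phase field is only Lipschitz continuous in general, so that its gradient in the form
  below is the weak one.\<close>

definition phase_form ::
    "'a::euclidean_space set \<Rightarrow> real \<Rightarrow> ('a \<Rightarrow> real) \<Rightarrow> ('a \<Rightarrow> real) \<Rightarrow> ('a \<Rightarrow> 'a) \<Rightarrow> ('a \<Rightarrow> real) \<Rightarrow>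
     ('a \<Rightarrow> real) \<Rightarrow> ('a \<Rightarrow> real) \<Rightarrow> real" where
  "phase_form B \<epsilon> \<phi> D b m u v =
     (LINT x|lebesgue_on B.
        \<phi> x * D x * (weak_grad B u x \<bullet> weak_grad B v x)
      + D x / \<epsilon> ^ 3 * (1 - \<phi> x) * u x * v x
      + \<phi> x * (b x \<bullet> weak_grad B u x) * v x
      + max (b x \<bullet> weak_grad B \<phi> x) 0 * u x * v x
      + \<phi> x * m x * u x * v x)"

definition phase_norm ::
    "'a::euclidean_space set \<Rightarrow> real \<Rightarrow> ('a \<Rightarrow> real) \<Rightarrow> ('a \<Rightarrow> real) \<Rightarrow> real" where
  "phase_norm B \<epsilon> \<phi> u =
     sqrt (LINT x|lebesgue_on B.
        \<phi> x * (norm (weak_grad B u x))\<^sup>2 + 1 / \<epsilon> ^ 3 * (1 - \<phi> x) * \<bar>u x\<bar>\<^sup>2)"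

end

theory Submission
  imports Defs
begin

text \<open>Integrating the convective term by parts gives
  \<open>\<integral> \<phi> (b \<cdot> \<nabla>u) u = - 1/2 \<integral> (\<phi> div b + b \<cdot> \<nabla>\<phi>) u\<^sup>2\<close>, and
  \<open>[b \<cdot> \<nabla>\<phi>]\<^sup>+ - 1/2 b \<cdot> \<nabla>\<phi> \<ge> 0\<close>, so coercivity holds with \<open>C = d\<close>. The work lies in the
  integration by parts: \<open>\<phi>\<close> is only Lipschitz and \<open>b\<close> only \<open>W\<^sup>1\<^sup>,\<^sup>\<infinity>\<close>. It rests on smooth approximations
  of \<open>\<phi>\<close> that converge uniformly, with bounded partial derivatives converging almost everywhere,
  and on the uniqueness of weak derivatives.\<close>

section \<open>Smooth functions\<close>

text \<open>\<open>weak_pderiv\<close> is an arbitrary choice of representative, so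
  \<open>weak_grad\<close> and \<open>weak_div\<close> cannot be computed: they are identified
  almost everywhere with concrete candidates by uniqueness, and measurability and bounds are
  transferred along these identities. The obstacle is the product rule for
  \<open>b x \<bullet> i\<close> times \<open>\<phi>\<close>, where neither factor is smooth. Only
  \<open>\<phi>\<close> is smoothed, to \<open>F n\<close>. Then \<open>F n\<close> times a test
  function is again a test function, so the definition of the weak derivative of
  \<open>b x \<bullet> i\<close> applies to it directly. Weak convergence of the derivatives would
  suffice there in principle; bounded convergence almost everywhere reduces the limit to dominated
  convergence. The function \<open>u\<close> is treated last: the bounded coefficient
  \<open>(b x \<bullet> i) * \<phi> x\<close> is tested against the square of a test function, whose
  derivative carries the factor 2 behind the 1/2 in the identity, and the result passes to
  \<open>u\<close> by convergence in \<open>H10\<close>.\<close>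

definition smooth :: "('a::euclidean_space \<Rightarrow> real) \<Rightarrow> bool" where
  "smooth f \<longleftrightarrow> (\<forall>k. Ck_on k UNIV f)"

lemma smooth_differentiable: "smooth f \<Longrightarrow> f differentiable (at x)"
  unfolding smooth_def by (metis Ck_on.simps(2) UNIV_I)

lemma smooth_has_derivative:
  "smooth f \<Longrightarrow> (f has_derivative frechet_derivative f (at x)) (at x)"
  using smooth_differentiable frechet_derivative_works by blast

lemma smooth_continuous_on: "smooth f \<Longrightarrow> continuous_on S f"
  unfolding smooth_def by (metis Ck_on.simps(1) continuous_on_subset subset_UNIV)

lemma smooth_pderiv:
  "smooth f \<Longrightarrow> i \<in> Basis \<Longrightarrow> smooth (\<lambda>x. frechet_derivative f (at x) i)"
  unfolding smooth_def by (metis Ck_on.simps(2))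

text \<open>\<open>Ck_on\<close> recurses through partial derivatives, so induction on
  \<open>k\<close> puts any class of differentiable functions closed under partial derivatives into
  every \<open>Ck_on k UNIV\<close>. Smoothness then needs no formula for higher derivatives, only a
  suitable invariant class \<open>X\<close>.\<close>

lemma smooth_coinduct:
  assumes "f \<in> X"
    and diff: "\<And>g x. g \<in> X \<Longrightarrow> g differentiable (at x)"
    and pd: "\<And>g i. g \<in> X \<Longrightarrow> i \<in> Basis \<Longrightarrow> (\<lambda>x. frechet_derivative g (at x) i) \<in> X"
  shows "smooth f"
proof -
  have "\<forall>g\<in>X. Ck_on k UNIV g" for k
  proof (induction k)
    case 0
    then show ?case
      using diff by (auto intro!: continuous_at_imp_continuous_on differentiable_imp_continuous_within)
  next
    case (Suc k)
    then show ?case using diff pd by auto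
  qed
  with assms(1) show ?thesis by (auto simp: smooth_def)
qed

text \<open>Lowers the order of the undifferentiated factors that the product rule leaves
  behind.\<close>

lemma Ck_on_SucD: "Ck_on (Suc k) UNIV f \<Longrightarrow> Ck_on k UNIV f"
proof (induction k arbitrary: f)
  case 0
  then show ?case
    by (auto intro!: continuous_at_imp_continuous_on differentiable_imp_continuous_within)
next
  case (Suc k)
  then show ?case by (metis Ck_on.simps(2))
qed

lemma Ck_on_add: "Ck_on k UNIV f \<Longrightarrow> Ck_on k UNIV g \<Longrightarrow> Ck_on k UNIV (\<lambda>x. f x + g x)"
proof (induction k arbitrary: f g)
  case 0
  then show ?case by (auto intro: continuous_intros)
next
  case (Suc k)
  then have d: "f differentiable at x" "g differentiable at x" for x by auto
  have eq: "frechet_derivative (\<lambda>x. f x + g x) (at x)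
    = (\<lambda>h. frechet_derivative f (at x) h + frechet_derivative g (at x) h)" for x
    using d by (intro frechet_derivative_at[symmetric] has_derivative_add)
      (simp_all add: frechet_derivative_works[symmetric])
  have "Ck_on k UNIV (\<lambda>x. frechet_derivative f (at x) i + frechet_derivative g (at x) i)"
    if "i \<in> Basis" for i
    using Suc.prems that by (intro Suc.IH) auto
  moreover have "(\<lambda>x. f x + g x) differentiable (at x)" for x using d by simp
  ultimately show ?case by (simp add: eq)
qed

lemma Ck_on_mult: "Ck_on k UNIV f \<Longrightarrow> Ck_on k UNIV g \<Longrightarrow> Ck_on k UNIV (\<lambda>x. f x * g x)"
proof (induction k arbitrary: f g)
  case 0
  then show ?case by (auto intro: continuous_intros)
next
  case (Suc k)
  then have d: "f differentiable at x" "g differentiable at x" for x by auto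
  have eq: "frechet_derivative (\<lambda>x. f x * g x) (at x)
    = (\<lambda>h. f x * frechet_derivative g (at x) h + frechet_derivative f (at x) h * g x)" for x
    using d by (intro frechet_derivative_at[symmetric] has_derivative_mult)
      (simp_all add: frechet_derivative_works[symmetric])
  have "Ck_on k UNIV (\<lambda>x. f x * frechet_derivative g (at x) i + frechet_derivative f (at x) i * g x)"
    if "i \<in> Basis" for i
    using Suc.prems that Ck_on_SucD[OF Suc.prems(1)] Ck_on_SucD[OF Suc.prems(2)]
    by (intro Ck_on_add Suc.IH) simp_all
  moreover have "(\<lambda>x. f x * g x) differentiable (at x)" for x using d by simp
  ultimately show ?case by (simp add: eq)
qed

lemma smooth_add: "smooth f \<Longrightarrow> smooth g \<Longrightarrow> smooth (\<lambda>x. f x + g x)"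
  by (simp add: smooth_def Ck_on_add)

lemma smooth_mult: "smooth f \<Longrightarrow> smooth g \<Longrightarrow> smooth (\<lambda>x. f x * g x)"
  by (simp add: smooth_def Ck_on_mult)

lemma smooth_const: "smooth (\<lambda>_. c)"
  by (rule smooth_coinduct[where X = "range (\<lambda>c _. c)"]) auto

lemma smooth_diff:
  assumes "smooth f" "smooth g" shows "smooth (\<lambda>x. f x - g x)"
  using smooth_add[OF assms(1) smooth_mult[OF smooth_const[of "-1"] assms(2)]] by simp

lemma smooth_power: "smooth f \<Longrightarrow> smooth (\<lambda>x. f x ^ n)"
  by (induction n) (auto intro: smooth_const smooth_mult)

lemma smooth_prod:
  "finite A \<Longrightarrow> (\<And>i. i \<in> A \<Longrightarrow> smooth (f i)) \<Longrightarrow> smooth (\<lambda>x. \<Prod>i\<in>A. f i x)"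
  by (induction A rule: finite_induct) (auto intro: smooth_const smooth_mult)

lemma frechet_derivative_mult:
  assumes "smooth f" "smooth g"
  shows "frechet_derivative (\<lambda>x. f x * g x) (at x) i
    = f x * frechet_derivative g (at x) i + frechet_derivative f (at x) i * g x"
  using frechet_derivative_at[OF has_derivative_mult[OF smooth_has_derivative[OF assms(1), of x]
      smooth_has_derivative[OF assms(2), of x]], symmetric]
  by simp

lemma frechet_derivative_add:
  assumes "smooth f" "smooth g"
  shows "frechet_derivative (\<lambda>x. f x + g x) (at x) i
    = frechet_derivative f (at x) i + frechet_derivative g (at x) i"
  using frechet_derivative_at[OF has_derivative_add[OF smooth_has_derivative[OF assms(1), of x]
      smooth_has_derivative[OF assms(2), of x]], symmetric]
  by simp

section \<open>Bump functions\<close>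

text \<open>\<open>exp_poly 1\<close> is the classical flat function exp(-1/t). The polynomial
  factor in 1/t makes the family closed under differentiation: with s = 1/t, differentiating
  replaces p by s^2 (p - p').\<close>

definition exp_poly :: "real poly \<Rightarrow> real \<Rightarrow> real" where
  "exp_poly p t = (if t > 0 then poly p (1 / t) * exp (- (1 / t)) else 0)"

lemma poly_times_exp_tendsto_0: "((\<lambda>s. poly p s * exp (- s)) \<longlongrightarrow> (0::real)) at_top"
proof -
  have "((\<lambda>s. \<Sum>i\<le>degree p. coeff p i * (s ^ i / exp s)) \<longlongrightarrow> (\<Sum>i\<le>degree p. coeff p i * 0)) at_top"
    by (intro tendsto_intros tendsto_power_div_exp_0)
  then show ?thesis
    by (simp add: poly_altdef sum_distrib_right exp_minus divide_inverse mult.assoc)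
qed

lemma exp_poly_has_real_derivative:
  "(exp_poly p has_real_derivative exp_poly ([:0, 0, 1:] * (p - pderiv p)) t) (at t)"
proof -
  consider "t > 0" | "t < 0" | "t = 0" by linarith
  then show ?thesis
  proof cases
    case 1
    have inv: "((\<lambda>t. 1 / t) has_real_derivative - (1 / t * (1 / t))) (at t)"
      using 1 by (auto intro!: derivative_eq_intros)
    have "((\<lambda>t. poly p (1 / t) * exp (- (1 / t))) has_real_derivative
        poly (pderiv p) (1 / t) * - (1 / t * (1 / t)) * exp (- (1 / t))
        + exp (- (1 / t)) * - (- (1 / t * (1 / t))) * poly p (1 / t)) (at t)"
      by (intro DERIV_mult DERIV_chain2[OF poly_DERIV inv] DERIV_chain2[OF DERIV_exp]
          DERIV_minus inv)
    also have "poly (pderiv p) (1 / t) * - (1 / t * (1 / t)) * exp (- (1 / t))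
        + exp (- (1 / t)) * - (- (1 / t * (1 / t))) * poly p (1 / t)
        = exp_poly ([:0, 0, 1:] * (p - pderiv p)) t"
      using 1 by (simp add: exp_poly_def algebra_simps)
    finally have "((\<lambda>t. poly p (1 / t) * exp (- (1 / t))) has_real_derivative
        exp_poly ([:0, 0, 1:] * (p - pderiv p)) t) (at t)" .
    then show ?thesis
      by (rule has_field_derivative_transform_within_open[of _ _ _ "{0<..}"]) (use 1 in \<open>auto simp: exp_poly_def\<close>)
  next
    case 2
    have "((\<lambda>t::real. 0) has_real_derivative exp_poly ([:0, 0, 1:] * (p - pderiv p)) t) (at t)"
      using 2 by (simp add: exp_poly_def)
    then show ?thesis
      by (rule has_field_derivative_transform_within_open[of _ _ _ "{..<0}"]) (use 2 in \<open>auto simp: exp_poly_def\<close>)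
  next
    case 3
    \<comment> \<open>The difference quotient at 0 divides by \<open>h\<close>, that is, multiplies
      by s = 1/h. The factor \<open>[:0, 1:]\<close> absorbs this into the polynomial, and the
      exponential decay in s wins.\<close>
    have "((\<lambda>h. poly ([:0, 1:] * p) (inverse h) * exp (- inverse h)) \<longlongrightarrow> 0) (at_right 0)"
      by (rule filterlim_compose[OF poly_times_exp_tendsto_0 filterlim_inverse_at_top_right])
    then have r: "((\<lambda>h. exp_poly p h / h) \<longlongrightarrow> 0) (at_right 0)"
      by (rule Lim_transform_eventually)
        (auto simp: exp_poly_def eventually_at_filter divide_inverse mult_ac)
    have l: "((\<lambda>h. exp_poly p h / h) \<longlongrightarrow> 0) (at_left 0)"
      by (rule tendsto_eventually) (auto simp: exp_poly_def eventually_at_filter)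
    have "((\<lambda>h. (exp_poly p (0 + h) - exp_poly p 0) / h) \<longlongrightarrow> 0) (at 0)"
      using r l by (simp add: filterlim_split_at exp_poly_def)
    then show ?thesis using 3 by (simp add: DERIV_def exp_poly_def)
  qed
qed

text \<open>The invariant class carries a free scalar \<open>d\<close> and a free polynomial
  \<open>p\<close>: the inner derivative \<open>s * (i \<bullet> j)\<close> is constant and joins
  \<open>d\<close>, the outer one only changes \<open>p\<close>.\<close>

lemma smooth_exp_poly_affine: "smooth (\<lambda>x::'a::euclidean_space. exp_poly p (c + s * (x \<bullet> j)))"
proof (rule smooth_coinduct)
  let ?X = "{(\<lambda>x::'a. d * exp_poly p (c + s * (x \<bullet> j))) | d p. True}"
  show "(\<lambda>x. exp_poly p (c + s * (x \<bullet> j))) \<in> ?X"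
    by (rule CollectI) (rule exI[of _ 1], auto)
  have D: "((\<lambda>x. d * exp_poly p (c + s * (x \<bullet> j))) has_derivative
      (\<lambda>h. d * (s * (h \<bullet> j)) * exp_poly ([:0, 0, 1:] * (p - pderiv p)) (c + s * (x \<bullet> j)))) (at x)"
    for d p and x :: 'a
  proof -
    have "((\<lambda>x. exp_poly p (c + s * (x \<bullet> j))) has_derivative
      (\<lambda>h. (s * (h \<bullet> j)) * exp_poly ([:0, 0, 1:] * (p - pderiv p)) (c + s * (x \<bullet> j)))) (at x)"
      by (rule has_derivative_eq_rhs, rule has_derivative_compose[OF _
          exp_poly_has_real_derivative[unfolded has_field_derivative_def]])
        (auto intro!: derivative_eq_intros)
    from has_derivative_mult_right[OF this, of d] show ?thesis by (simp add: mult_ac)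
  qed
  fix g assume g: "g \<in> ?X"
  then obtain d p where gd: "g = (\<lambda>x::'a. d * exp_poly p (c + s * (x \<bullet> j)))" by auto
  show "g differentiable (at x)" for x
    unfolding gd using D by (auto simp: differentiable_def)
  show "(\<lambda>x. frechet_derivative g (at x) i) \<in> ?X" for i
    unfolding gd
  proof (subst frechet_derivative_at[OF D, symmetric], rule CollectI)
    show "\<exists>d' q. (\<lambda>x. d * (s * (i \<bullet> j)) * exp_poly ([:0, 0, 1:] * (p - pderiv p)) (c + s * (x \<bullet> j)))
      = (\<lambda>x. d' * exp_poly q (c + s * (x \<bullet> j))) \<and> True"
      by (intro exI conjI TrueI) (rule refl)
  qed
qed

text \<open>A product over coordinates instead of a radial bump: it is smooth factor by factor, and
  its set of positivity is exactly the open box, which fits integrals over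
  \<open>cbox\<close>.\<close>

definition bump :: "'a::euclidean_space \<Rightarrow> 'a \<Rightarrow> 'a \<Rightarrow> real" where
  "bump a b x = (\<Prod>i\<in>Basis. exp_poly 1 ((x - a) \<bullet> i) * exp_poly 1 ((b - x) \<bullet> i))"

lemma smooth_bump: "smooth (bump a b)"
proof -
  have "smooth (\<lambda>x::'a. exp_poly 1 ((x - a) \<bullet> i))" "smooth (\<lambda>x::'a. exp_poly 1 ((b - x) \<bullet> i))" for i
    using smooth_exp_poly_affine[of 1 "- (a \<bullet> i)" 1 i] smooth_exp_poly_affine[of 1 "b \<bullet> i" "-1" i]
    by (simp_all add: inner_diff_left)
  then show ?thesis unfolding bump_def[abs_def] by (intro smooth_prod smooth_mult) auto
qed

lemma exp_poly_1_bounds: "0 \<le> exp_poly 1 t" "exp_poly 1 t \<le> 1"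
  by (auto simp: exp_poly_def)

lemma bump_bounds: "0 \<le> bump a b x" "bump a b x \<le> 1"
proof -
  have "0 \<le> exp_poly 1 s * exp_poly 1 t" "exp_poly 1 s * exp_poly 1 t \<le> 1" for s t
    by (simp_all add: exp_poly_1_bounds mult_le_one)
  then show "0 \<le> bump a b x" "bump a b x \<le> 1"
    unfolding bump_def by (simp_all add: prod_nonneg prod_le_1)
qed

lemma bump_pos_iff: "0 < bump a b x \<longleftrightarrow> x \<in> box a b"
proof -
  have p: "0 < exp_poly 1 s * exp_poly 1 t \<longleftrightarrow> 0 < s \<and> 0 < t" for s t
    by (auto simp: exp_poly_def)
  have "0 < bump a b x \<longleftrightarrow> (\<forall>i\<in>Basis. 0 < exp_poly 1 ((x - a) \<bullet> i) * exp_poly 1 ((b - x) \<bullet> i))"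
  proof
    assume "0 < bump a b x"
    then have "exp_poly 1 ((x - a) \<bullet> i) * exp_poly 1 ((b - x) \<bullet> i) \<noteq> 0" if "i \<in> Basis" for i
      unfolding bump_def using that by (metis (no_types, lifting) finite_Basis less_irrefl prod_zero)
    then show "\<forall>i\<in>Basis. 0 < exp_poly 1 ((x - a) \<bullet> i) * exp_poly 1 ((b - x) \<bullet> i)"
      by (simp add: exp_poly_1_bounds(1) less_le)
  qed (auto simp: bump_def intro!: prod_pos)
  also have "\<dots> \<longleftrightarrow> x \<in> box a b"
    by (auto simp: mem_box p inner_diff_left)
  finally show ?thesis .
qed

lemma bump_eq_0: "x \<notin> box a b \<Longrightarrow> bump a b x = 0"
  using bump_pos_iff[of a b x] bump_bounds(1)[of a b x] by linarith

section \<open>Test functions\<close>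

lemma test_functionI:
  assumes "smooth \<psi>" "compact K" "K \<subseteq> B" "\<And>x. x \<notin> K \<Longrightarrow> \<psi> x = 0"
  shows "test_function B \<psi>"
proof -
  let ?S = "{x. \<psi> x \<noteq> 0}"
  have sub: "closure ?S \<subseteq> K"
    by (rule closure_minimal) (use assms compact_imp_closed in auto)
  then have "K \<inter> closure ?S = closure ?S" by (rule inf.absorb2)
  then have "compact (closure ?S)"
    using compact_Int_closed[OF assms(2) closed_closure, of ?S] by simp
  with sub assms(1,3) show ?thesis by (simp add: test_function_def smooth_def)
qed

lemma test_function_smooth: "test_function B \<psi> \<Longrightarrow> smooth \<psi>"
  by (simp add: test_function_def smooth_def)

text \<open>The complement of the closed support is open, so \<open>\<psi>\<close> is locally zero
  there and its derivative vanishes too. One compact \<open>K\<close> thus serves both sides of the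
  weak derivative identity.\<close>

lemma test_function_support:
  assumes "test_function B \<psi>"
  shows "\<exists>K. compact K \<and> K \<subseteq> B \<and>
    (\<forall>x. x \<notin> K \<longrightarrow> \<psi> x = 0 \<and> (\<forall>i. frechet_derivative \<psi> (at x) i = 0))"
proof (intro exI conjI allI impI)
  let ?S = "{x. \<psi> x \<noteq> 0}"
  show "compact (closure ?S)" "closure ?S \<subseteq> B" using assms by (simp_all add: test_function_def)
  show z: "\<psi> x = 0" if "x \<notin> closure ?S" for x using that closure_subset[of ?S] by auto
  show "frechet_derivative \<psi> (at x) i = 0" if "x \<notin> closure ?S" for x i
  proof -
    have "((\<lambda>_. 0) has_derivative (\<lambda>_. 0)) (at x)" by simp
    then have "(\<psi> has_derivative (\<lambda>_. 0)) (at x)"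
    proof (rule has_derivative_transform_within_open)
      show "open (- closure ?S)" "x \<in> - closure ?S" using that by auto
      show "0 = \<psi> y" if "y \<in> - closure ?S" for y using z[of y] that by simp
    qed
    from frechet_derivative_at[OF this, symmetric] show ?thesis by simp
  qed
qed

lemma test_function_mult:
  assumes "smooth f" "test_function B \<psi>" shows "test_function B (\<lambda>x. f x * \<psi> x)"
proof -
  obtain K where "compact K" "K \<subseteq> B" "\<forall>x. x \<notin> K \<longrightarrow> \<psi> x = 0"
    using test_function_support[OF assms(2)] by blast
  then show ?thesis
    using assms(1) test_function_smooth[OF assms(2)]
    by (intro test_functionI[of _ K]) (simp_all add: smooth_mult)
qed

section \<open>Smoothing of Lipschitz functions\<close>

text \<open>Derivatives fall on the kernel alone, so the convolutions of the fixed continuous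
  \<open>f\<close> with all smooth kernels form a class invariant under partial derivatives.\<close>

lemma smooth_convolution:
  fixes f :: "'a::euclidean_space \<Rightarrow> real"
  assumes f: "continuous_on (cbox a b) f" and K: "smooth K"
  shows "smooth (\<lambda>x. integral (cbox a b) (\<lambda>y. f y * K (x - y)))"
proof (rule smooth_coinduct)
  let ?F = "\<lambda>K x. integral (cbox a b) (\<lambda>y. f y * K (x - y))"
  let ?X = "?F ` Collect smooth"
  show "?F K \<in> ?X" using K by blast
  have D: "(?F K has_derivative
      (\<lambda>v. integral (cbox a b) (\<lambda>y. f y * frechet_derivative K (at (x - y)) v))) (at x)"
    if K: "smooth K" for K x
  proof -
    \<comment> \<open>\<open>leibniz_rule\<close> takes the derivative as a continuous map into
      bounded linear operators. Its continuity is checked on basis vectors, where it is the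
      continuity of partial derivatives.\<close>
    define G where "G = (\<lambda>x. Blinfun (frechet_derivative K (at x)))"
    have G: "blinfun_apply (G x) = frechet_derivative K (at x)" for x
      unfolding G_def
      by (rule bounded_linear_Blinfun_apply) (rule has_derivative_bounded_linear[OF smooth_has_derivative[OF K]])
    have contG: "continuous_on UNIV G"
      by (rule continuous_on_blinfun_componentwise) (simp add: G smooth_continuous_on smooth_pderiv K)
    define fx where "fx = (\<lambda>x y. f y *\<^sub>R G (x - y))"
    have cont_fx: "continuous_on (UNIV \<times> cbox a b) (\<lambda>(x, y). fx x y)"
      unfolding fx_def split_beta
      by (intro continuous_intros continuous_on_compose2[OF f] continuous_on_compose2[OF contG]) auto
    have "(?F K has_derivative integral (cbox a b) (fx x)) (at x within UNIV)"
    proof (rule leibniz_rule[OF _ _ cont_fx])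
      fix x y
      show "((\<lambda>x. f y * K (x - y)) has_derivative blinfun_apply (fx x y)) (at x within UNIV)"
        unfolding fx_def blinfun.scaleR_left G
        by (rule has_derivative_eq_rhs, rule has_derivative_mult_right,
            rule has_derivative_compose[OF _ smooth_has_derivative[OF K]])
          (auto intro!: derivative_eq_intros)
      show "(\<lambda>y. f y * K (x - y)) integrable_on cbox a b"
        by (intro integrable_continuous continuous_intros f
            continuous_on_compose2[OF smooth_continuous_on[OF K, of UNIV]]) auto
    qed auto
    moreover have "fx x integrable_on cbox a b"
      unfolding fx_def
      by (intro integrable_continuous continuous_intros f continuous_on_compose2[OF contG]) auto
    then have "blinfun_apply (integral (cbox a b) (fx x))
        = (\<lambda>v. integral (cbox a b) (\<lambda>y. f y * frechet_derivative K (at (x - y)) v))"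
      by (simp add: blinfun_apply_integral fun_eq_iff) (simp add: fx_def blinfun.scaleR_left G)
    ultimately show ?thesis by simp
  qed
  fix g assume "g \<in> ?X"
  then obtain K where K: "smooth K" and g: "g = ?F K" by auto
  show "g differentiable (at x)" for x using D[OF K] unfolding g differentiable_def by blast
  show "(\<lambda>x. frechet_derivative g (at x) i) \<in> ?X" if "i \<in> Basis" for i
  proof -
    have "frechet_derivative g (at x) i = integral (cbox a b) (\<lambda>y. f y * frechet_derivative K (at (x - y)) i)"
      for x unfolding g frechet_derivative_at[OF D[OF K], symmetric] ..
    then show ?thesis using smooth_pderiv[OF K that] by auto
  qed
qed

text \<open>The derivative in direction \<open>v\<close> is a limit of difference quotients along a
  line through \<open>x\<close>, each bounded by \<open>L * norm v\<close>. Since \<open>B\<close>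
  is open, small steps stay in \<open>B\<close>, so the Lipschitz bound on \<open>B\<close> is
  enough.\<close>

lemma lipschitz_pderiv_bound:
  fixes F :: "'a::euclidean_space \<Rightarrow> real"
  assumes "(F has_derivative F') (at x)" "open B" "x \<in> B"
    and lip: "\<And>y. y \<in> B \<Longrightarrow> \<bar>F y - F x\<bar> \<le> L * norm (y - x)"
  shows "\<bar>F' v\<bar> \<le> L * norm v"
proof -
  have "((\<lambda>t. F (x + t *\<^sub>R v)) has_derivative (\<lambda>t. F' (t *\<^sub>R v))) (at 0)"
    by (rule has_derivative_compose[of "\<lambda>t. x + t *\<^sub>R v"])
      (use assms(1) in \<open>auto intro!: derivative_eq_intros\<close>)
  moreover have "F' (t *\<^sub>R v) = F' v * t" for t
    using linear_scale[OF has_derivative_linear[OF assms(1)]] by simp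
  ultimately have "((\<lambda>t. F (x + t *\<^sub>R v)) has_real_derivative F' v) (at 0)"
    by (simp add: has_field_derivative_def)
  then have lim: "((\<lambda>h. \<bar>(F (x + h *\<^sub>R v) - F x) / h\<bar>) \<longlongrightarrow> \<bar>F' v\<bar>) (at 0)"
    by (intro tendsto_rabs) (simp add: DERIV_def)
  have "((\<lambda>h. x + h *\<^sub>R v) \<longlongrightarrow> x + 0 *\<^sub>R v) (at (0::real))"
    by (intro tendsto_intros)
  then have "\<forall>\<^sub>F h in at (0::real). x + h *\<^sub>R v \<in> B"
    using topological_tendstoD[OF _ assms(2)] assms(3) by fastforce
  then have "\<forall>\<^sub>F h in at (0::real). \<bar>(F (x + h *\<^sub>R v) - F x) / h\<bar> \<le> L * norm v"
  proof (rule eventually_elim2[OF _ eventually_at_filter[THEN iffD2, OF always_eventually]])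
    show "\<forall>h. h \<noteq> (0::real) \<longrightarrow> h \<in> UNIV \<longrightarrow> h \<noteq> 0" by simp
    fix h :: real assume "x + h *\<^sub>R v \<in> B" "h \<noteq> 0"
    with lip[of "x + h *\<^sub>R v"] show "\<bar>(F (x + h *\<^sub>R v) - F x) / h\<bar> \<le> L * norm v"
      by (simp add: abs_divide field_simps)
  qed
  with lim show ?thesis by (rule tendsto_upperbound) simp
qed

text \<open>A bump divided by its integral. That integral is positive, since a continuous
  nonnegative function with zero integral over the box would vanish at the centre 0, where the bump
  is positive.\<close>

lemma smooth_mollifier:
  fixes d :: "'a::euclidean_space"
  assumes "\<And>i. i \<in> Basis \<Longrightarrow> 0 < d \<bullet> i"
  obtains K :: "'a \<Rightarrow> real" where "smooth K" "\<forall>x. 0 \<le> K x"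
    "\<forall>x. x \<notin> cbox (- d) d \<longrightarrow> K x = 0"
    "(K has_integral 1) (cbox (- d) d)"
proof -
  define c where "c = integral (cbox (- d) d) (bump (- d) d)"
  have cont: "continuous_on (cbox (- d) d) (bump (- d) d)"
    by (rule smooth_continuous_on[OF smooth_bump])
  then have hi: "(bump (- d) d has_integral c) (cbox (- d) d)"
    unfolding c_def by (intro integrable_integral integrable_continuous)
  have "0 \<in> box (- d) d" using assms by (auto simp: mem_box)
  then have pos: "bump (- d) d 0 > 0" "0 \<in> cbox (- d) d" "box (- d) d \<noteq> {}"
    using box_subset_cbox by (auto simp: bump_pos_iff)
  have "c \<noteq> 0"
  proof
    assume "c = 0"
    then have "bump (- d) d 0 = 0"
      using hi pos by (intro has_integral_0_cbox_imp_0[OF cont bump_bounds(1)]) simp_all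
    with pos show False by simp
  qed
  moreover have "c \<ge> 0" unfolding c_def by (rule integral_nonneg)
      (use hi bump_bounds(1) in \<open>auto simp: integrable_on_def\<close>)
  ultimately have c: "c > 0" by simp
  show thesis
  proof (rule that[of "\<lambda>x. 1 / c * bump (- d) d x"])
    show "smooth (\<lambda>x. 1 / c * bump (- d) d x)" by (intro smooth_mult smooth_const smooth_bump)
    show "\<forall>x. 0 \<le> 1 / c * bump (- d) d x" using c bump_bounds(1)[of "- d" d] by simp
    show "\<forall>x. x \<notin> cbox (- d) d \<longrightarrow> 1 / c * bump (- d) d x = 0"
      using bump_eq_0[of _ "- d" d] box_subset_cbox[of "- d" d] by auto
    show "((\<lambda>x. 1 / c * bump (- d) d x) has_integral 1) (cbox (- d) d)"
      using has_integral_mult_right[OF hi, of "1 / c"] c by simp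
  qed
qed

text \<open>The substitution z = x - y turns a convolution into an average of translates
  \<open>f (x - z)\<close> over a box that does not move with \<open>x\<close>.\<close>

lemma has_integral_reflect_cbox:
  fixes g :: "'a::euclidean_space \<Rightarrow> real"
  assumes "(g has_integral I) (cbox (- d) d)" "cbox (- d) d \<noteq> {}"
  shows "((\<lambda>y. g (x - y)) has_integral I) (cbox (x - d) (x + d))"
  using has_integral_affinity[OF assms(1), of "-1" x] assms(2)
    image_affinity_cbox[of "-1" x "- d" d]
  by (simp add: algebra_simps)

text \<open>On \<open>B\<close> the mollification is an average, with nonnegative weights
  \<open>K\<close> of mass 1, of the translates \<open>f (x - z)\<close> with small
  \<open>z\<close>. Averaging keeps the Lipschitz constant and moves values by at most
  \<open>L\<close> times the size of \<open>z\<close>.\<close>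

lemma lipschitz_smooth_approx:
  fixes f :: "'a::euclidean_space \<Rightarrow> real"
  assumes lip: "L-lipschitz_on UNIV f" and B: "open B" "bounded B" and "e > 0"
  shows "\<exists>F. smooth F \<and> (\<forall>x\<in>B. \<bar>F x - f x\<bar> \<le> e) \<and>
    (\<forall>x\<in>B. \<forall>i\<in>Basis. \<bar>frechet_derivative F (at x) i\<bar> \<le> L)"
proof -
  have L: "L \<ge> 0" using lip by (rule lipschitz_on_nonneg)
  have lipf: "\<bar>f x - f y\<bar> \<le> L * norm (x - y)" for x y
    using lipschitz_onD[OF lip, of x y] by (simp add: dist_norm)
  have contf: "continuous_on S f" for S
    using lipschitz_on_continuous_on[OF lip] continuous_on_subset by blast
  \<comment> \<open>Chosen so that \<open>L * norm z \<le> e\<close> on the kernel box, where the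
    sum norm gives \<open>norm z \<le> \<delta> * DIM('a)\<close>. The summand 1 keeps the
    denominator positive when \<open>L = 0\<close>.\<close>
  define \<delta> where "\<delta> = e / (L * DIM('a) + 1)"
  have "L * DIM('a) \<ge> 0" using L by simp
  then have \<delta>: "\<delta> > 0" "L * (\<delta> * DIM('a)) \<le> e"
    using \<open>e > 0\<close> by (simp_all add: \<delta>_def field_simps add_pos_nonneg)
  define d :: 'a where "d = \<delta> *\<^sub>R One"
  let ?C = "cbox (- d) d"
  have C: "?C \<noteq> {}" using \<delta> by (auto simp: d_def box_eq_empty)
  have normC: "norm z \<le> \<delta> * DIM('a)" if "z \<in> ?C" for z
  proof -
    have "norm z \<le> (\<Sum>i\<in>Basis. \<bar>z \<bullet> i\<bar>)" by (rule norm_le_l1)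
    also have "\<dots> \<le> (\<Sum>i\<in>(Basis::'a set). \<delta>)"
      using that by (intro sum_mono) (auto simp: mem_box d_def)
    finally show ?thesis by (simp add: mult.commute)
  qed
  have "0 < d \<bullet> i" if "i \<in> Basis" for i using that \<delta> by (simp add: d_def)
  then obtain K :: "'a \<Rightarrow> real" where K: "smooth K" "\<forall>x. 0 \<le> K x" "\<forall>x. x \<notin> ?C \<longrightarrow> K x = 0"
      "(K has_integral 1) ?C"
    by (rule smooth_mollifier)
  obtain p q where Q: "B \<subseteq> cbox p q" using bounded_subset_cbox_symmetric[OF B(2)] by blast
  \<comment> \<open>A fixed domain of integration is what \<open>smooth_convolution\<close> asks
    for. Enlarging the box around \<open>B\<close> by \<open>d\<close> makes it contain the whole
    support of the kernel around every \<open>x \<in> B\<close>.\<close>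
  define F where "F = (\<lambda>x. integral (cbox (p - d) (q + d)) (\<lambda>y. f y * K (x - y)))"
  have cont: "continuous_on S (\<lambda>z. f (x - z) * K z)" for x S
    by (intro continuous_intros smooth_continuous_on[OF K(1)] continuous_on_compose2[OF contf[of UNIV]]) auto
  then have int: "(\<lambda>z. f (x - z) * K z) integrable_on ?C" for x
    by (intro integrable_continuous)
  have F: "F x = integral ?C (\<lambda>z. f (x - z) * K z)" if "x \<in> B" for x
  proof -
    let ?I = "integral ?C (\<lambda>z. f (x - z) * K z)"
    have "((\<lambda>y. f y * K (x - y)) has_integral ?I) (cbox (x - d) (x + d))"
      using has_integral_reflect_cbox[OF integrable_integral[OF int[of x]] C, of x] by simp
    then have "((\<lambda>y. f y * K (x - y)) has_integral ?I) (cbox (p - d) (q + d))"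
    proof (rule has_integral_on_superset)
      show "f y * K (x - y) = 0" if "y \<notin> cbox (x - d) (x + d)" for y
      proof -
        have "y \<in> cbox (x - d) (x + d)" if "x - y \<in> ?C"
          unfolding mem_box
        proof
          fix i :: 'a assume "i \<in> Basis"
          then show "(x - d) \<bullet> i \<le> y \<bullet> i \<and> y \<bullet> i \<le> (x + d) \<bullet> i"
            using that by (fastforce simp: mem_box inner_diff_left inner_add_left)
        qed
        then have "x - y \<notin> ?C" using that by blast
        then show ?thesis by (simp add: K(3))
      qed
      show "cbox (x - d) (x + d) \<subseteq> cbox (p - d) (q + d)"
        using Q that by (intro subset_box_imp) (auto simp: mem_box inner_diff_left inner_add_left subset_iff)
    qed
    then show ?thesis by (simp add: F_def integral_unique)
  qed
  have K_int: "K integrable_on ?C" "integral ?C K = 1"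
    using K(4) by (auto simp: integral_unique integrable_on_def)
  have sm: "smooth F" unfolding F_def by (intro smooth_convolution contf K)
  show ?thesis
  proof (intro exI[of _ F] conjI ballI sm)
    fix x assume x: "x \<in> B"
    have "F x - f x = integral ?C (\<lambda>z. (f (x - z) - f x) * K z)"
      using K_int integral_diff[OF int[of x] integrable_on_mult_right[OF K_int(1), of "f x"]]
      by (simp add: F[OF x] left_diff_distrib)
    also have "\<bar>\<dots>\<bar> \<le> integral ?C (\<lambda>z. e * K z)"
      unfolding real_norm_def[symmetric]
    proof (rule integral_norm_bound_integral)
      show "(\<lambda>z. (f (x - z) - f x) * K z) integrable_on ?C"
        using integrable_diff[OF int[of x] integrable_on_mult_right[OF K_int(1), of "f x"]]
        by (simp add: left_diff_distrib)
      show "(\<lambda>z. e * K z) integrable_on ?C" using K_int(1) by (rule integrable_on_mult_right)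
      show "norm ((f (x - z) - f x) * K z) \<le> e * K z" if "z \<in> ?C" for z
      proof -
        have "\<bar>f (x - z) - f x\<bar> \<le> L * norm z" using lipf[of "x - z" x] by simp
        also have "\<dots> \<le> L * (\<delta> * DIM('a))" using normC[OF that] L by (rule mult_left_mono)
        finally have "\<bar>f (x - z) - f x\<bar> \<le> e" using \<delta>(2) by linarith
        then show ?thesis using K(2)[rule_format, of z] by (simp add: abs_mult mult_right_mono)
      qed
    qed
    also have "\<dots> = e" using K_int by simp
    finally show "\<bar>F x - f x\<bar> \<le> e" .
    fix i :: 'a assume i: "i \<in> Basis"
    have "\<bar>frechet_derivative F (at x) i\<bar> \<le> L * norm i"
    proof (rule lipschitz_pderiv_bound[OF smooth_has_derivative[OF sm] B(1) x])
      fix y assume y: "y \<in> B"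
      have "F y - F x = integral ?C (\<lambda>z. (f (y - z) - f (x - z)) * K z)"
        using int[of x] int[of y] by (simp add: F[OF x] F[OF y] left_diff_distrib integral_diff)
      also have "\<bar>\<dots>\<bar> \<le> integral ?C (\<lambda>z. (L * norm (y - x)) * K z)"
        unfolding real_norm_def[symmetric]
      proof (rule integral_norm_bound_integral)
        show "(\<lambda>z. (f (y - z) - f (x - z)) * K z) integrable_on ?C"
          using integrable_diff[OF int[of y] int[of x]] by (simp add: left_diff_distrib)
        show "(\<lambda>z. (L * norm (y - x)) * K z) integrable_on ?C"
          using K_int(1) by (rule integrable_on_mult_right)
        show "norm ((f (y - z) - f (x - z)) * K z) \<le> (L * norm (y - x)) * K z" for z
          using lipf[of "y - z" "x - z"] K(2)[rule_format, of z] by (simp add: abs_mult mult_right_mono)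
      qed
      also have "\<dots> = L * norm (y - x)" using K_int by simp
      finally show "\<bar>F y - F x\<bar> \<le> L * norm (y - x)" .
    qed
    then show "\<bar>frechet_derivative F (at x) i\<bar> \<le> L" using i by simp
  qed
qed

section \<open>Integration over sets\<close>

lemma continuous_measurable_lebesgue_on:
  fixes f :: "'a::euclidean_space \<Rightarrow> real"
  shows "continuous_on UNIV f \<Longrightarrow> S \<in> sets lebesgue \<Longrightarrow> f \<in> borel_measurable (lebesgue_on S)"
  by (meson continuous_imp_measurable_on_sets_lebesgue continuous_on_subset subset_UNIV)

lemma smooth_measurable:
  "smooth f \<Longrightarrow> S \<in> sets lebesgue \<Longrightarrow> f \<in> borel_measurable (lebesgue_on S)"
  by (simp add: continuous_measurable_lebesgue_on smooth_continuous_on)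

lemma bounded_integrable_lebesgue_on:
  fixes f :: "'a::euclidean_space \<Rightarrow> real"
  assumes "S \<in> lmeasurable" "f \<in> borel_measurable (lebesgue_on S)" "AE x in lebesgue_on S. \<bar>f x\<bar> \<le> C"
  shows "integrable (lebesgue_on S) f"
  using finite_measure.integrable_const_bound[OF finite_measure_lebesgue_on[OF assms(1)], of f C] assms
  by simp

lemma integrable_bounded_mult:
  fixes f h :: "'a \<Rightarrow> real"
  assumes f: "integrable M f" and h: "h \<in> borel_measurable M" and C: "AE x in M. \<bar>h x\<bar> \<le> C"
  shows "integrable M (\<lambda>x. f x * h x)"
proof (rule Bochner_Integration.integrable_bound)
  show "integrable M (\<lambda>x. C * f x)" using f by simp
  show "(\<lambda>x. f x * h x) \<in> borel_measurable M"
    using h borel_measurable_integrable[OF f] by simp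
  show "AE x in M. norm (f x * h x) \<le> norm (C * f x)"
    using C
  proof eventually_elim
    case (elim x)
    then have "\<bar>h x\<bar> \<le> \<bar>C\<bar>" by linarith
    then show ?case using mult_left_mono[of "\<bar>h x\<bar>" "\<bar>C\<bar>" "\<bar>f x\<bar>"] by (simp add: abs_mult mult.commute)
  qed
qed

lemma integral_lebesgue_on_zero_ext:
  fixes g :: "'a::euclidean_space \<Rightarrow> real"
  assumes "K \<subseteq> B" "K \<in> sets lebesgue" "B \<in> sets lebesgue" "\<And>x. x \<notin> K \<Longrightarrow> g x = 0"
  shows "integrable (lebesgue_on B) g \<longleftrightarrow> integrable (lebesgue_on K) g"
    and "(LINT x|lebesgue_on B. g x) = (LINT x|lebesgue_on K. g x)"
proof -
  have eq: "(\<lambda>x. indicator K x *\<^sub>R g x) = g" "(\<lambda>x. indicator B x *\<^sub>R g x) = g"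
    using assms(1,4) by (auto simp: indicator_def fun_eq_iff)
  show "integrable (lebesgue_on B) g \<longleftrightarrow> integrable (lebesgue_on K) g"
    using assms(2,3) by (simp add: integrable_restrict_space eq del: real_scaleR_def)
  show "(LINT x|lebesgue_on B. g x) = (LINT x|lebesgue_on K. g x)"
    using assms(2,3) by (simp add: integral_restrict_space eq del: real_scaleR_def)
qed

lemma continuous_bounded_on_compact:
  fixes h :: "'a::euclidean_space \<Rightarrow> real"
  assumes "continuous_on UNIV h" "compact K"
  obtains C where "\<forall>x\<in>K. \<bar>h x\<bar> \<le> C"
proof -
  have "bounded (h ` K)"
    using assms by (meson compact_continuous_image compact_imp_bounded continuous_on_subset subset_UNIV)
  then show ?thesis using that unfolding bounded_iff by auto
qed

text \<open>Makes pairings with test functions meaningful: \<open>f\<close> is controlled only on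
  compact sets, and the zeros of \<open>h\<close> outside \<open>K\<close> confine the integral over
  \<open>B\<close> to \<open>K\<close>.\<close>

lemma locally_integrable_mult:
  fixes f h :: "'a::euclidean_space \<Rightarrow> real"
  assumes f: "locally_integrable B f" and "open B" and h: "continuous_on UNIV h"
    and K: "compact K" "K \<subseteq> B" "\<And>x. x \<notin> K \<Longrightarrow> h x = 0"
  shows "integrable (lebesgue_on B) (\<lambda>x. f x * h x)"
    and "integrable (lebesgue_on K) (\<lambda>x. f x * h x)"
    and "(LINT x|lebesgue_on B. f x * h x) = (LINT x|lebesgue_on K. f x * h x)"
proof -
  have s: "K \<in> sets lebesgue" "B \<in> sets lebesgue"
    using K(1) \<open>open B\<close> by (auto simp: lmeasurable_compact fmeasurableD)
  obtain C where C: "\<forall>x\<in>K. \<bar>h x\<bar> \<le> C" using h K(1) by (rule continuous_bounded_on_compact)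
  have "integrable (lebesgue_on K) f" using f K by (simp add: locally_integrable_def)
  then show i: "integrable (lebesgue_on K) (\<lambda>x. f x * h x)"
    by (rule integrable_bounded_mult[where C = C])
      (use C in \<open>auto intro!: AE_I2 continuous_measurable_lebesgue_on h s\<close>)
  show "integrable (lebesgue_on B) (\<lambda>x. f x * h x)"
    using integral_lebesgue_on_zero_ext(1)[OF K(2) s, of "\<lambda>x. f x * h x"] K(3) i by simp
  show "(LINT x|lebesgue_on B. f x * h x) = (LINT x|lebesgue_on K. f x * h x)"
    using integral_lebesgue_on_zero_ext(2)[OF K(2) s, of "\<lambda>x. f x * h x"] K(3) by simp
qed

lemma continuous_locally_integrable:
  "continuous_on UNIV f \<Longrightarrow> locally_integrable B f"
  unfolding locally_integrable_def
proof safe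
  fix K :: "'a set" assume f: "continuous_on UNIV f" and K: "compact K"
  obtain C where "\<forall>x\<in>K. \<bar>f x\<bar> \<le> C" using f K by (rule continuous_bounded_on_compact)
  then show "integrable (lebesgue_on K) f"
    using K f by (intro bounded_integrable_lebesgue_on[of _ _ C] AE_I2 continuous_measurable_lebesgue_on)
      (auto simp: lmeasurable_compact fmeasurableD)
qed

lemma integrable_imp_locally_integrable:
  fixes f :: "'a::euclidean_space \<Rightarrow> real"
  assumes "integrable (lebesgue_on B) f" "B \<in> sets lebesgue"
  shows "locally_integrable B f"
  unfolding locally_integrable_def
proof safe
  fix K :: "'a set" assume K: "compact K" "K \<subseteq> B"
  then have s: "K \<in> sets lebesgue" by (simp add: lmeasurable_compact fmeasurableD)
  have "K \<in> sets (lebesgue_on B)" using K s assms(2) by (simp add: sets_restrict_space_iff)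
  then have "integrable (lebesgue_on B) (\<lambda>x. indicator K x *\<^sub>R f x)"
    using assms(1) by (rule integrable_mult_indicator)
  then have "integrable (lebesgue_on K) (\<lambda>x. indicator K x *\<^sub>R f x)"
    using integral_lebesgue_on_zero_ext(1)[OF K(2) s assms(2), of "\<lambda>x. indicator K x *\<^sub>R f x"] by simp
  then show "integrable (lebesgue_on K) f"
    by (rule Bochner_Integration.integrable_cong[THEN iffD1, rotated -1]) auto
qed

section \<open>Integration by parts against test functions\<close>

text \<open>The integral of a translate \<open>x \<mapsto> \<theta> (x + t i)\<close> does not depend on \<open>t\<close>; its derivative
  at \<open>t = 0\<close> is the integral in question.\<close>

lemma integral_pderiv_test_function:
  fixes \<theta> :: "'a::euclidean_space \<Rightarrow> real"
  assumes \<theta>: "test_function B \<theta>" and "open B" and i: "i \<in> Basis"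
  shows "(LINT x|lebesgue_on B. frechet_derivative \<theta> (at x) i) = 0"
proof -
  let ?d = "\<lambda>x. frechet_derivative \<theta> (at x) i"
  obtain K where K: "compact K" "K \<subseteq> B" and z: "\<forall>x. x \<notin> K \<longrightarrow> \<theta> x = 0 \<and> (\<forall>i. frechet_derivative \<theta> (at x) i = 0)"
    using test_function_support[OF \<theta>] by blast
  have sm: "smooth \<theta>" using \<theta> by (rule test_function_smooth)
  have s: "K \<in> sets lebesgue" using K(1) by (simp add: lmeasurable_compact fmeasurableD)
  have cd: "continuous_on S ?d" for S by (rule smooth_continuous_on[OF smooth_pderiv[OF sm i]])
  obtain a :: 'a where a: "K \<subseteq> cbox (- a) a" using bounded_subset_cbox_symmetric[OF compact_imp_bounded[OF K(1)]] by blast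
  \<comment> \<open>One extra \<open>i\<close> on either side keeps \<open>K\<close> inside every
    translate of the box by \<open>t *\<^sub>R i\<close> with
    \<open>t \<in> {-1..1}\<close>.\<close>
  let ?p = "- a - i" and ?q = "a + i"
  have box: "K \<subseteq> cbox (?p + t *\<^sub>R i) (?q + t *\<^sub>R i)" if "t \<in> {-1..1}" for t
  proof (rule subset_trans[OF a], rule subset_box_imp, intro ballI conjI)
    fix j :: 'a assume j: "j \<in> Basis"
    then have "0 \<le> i \<bullet> j" using i by (simp add: inner_Basis)
    then have "t * (i \<bullet> j) \<le> 1 * (i \<bullet> j)" "- 1 * (i \<bullet> j) \<le> t * (i \<bullet> j)"
      using that by (intro mult_right_mono; simp)+
    then show "(?p + t *\<^sub>R i) \<bullet> j \<le> (- a) \<bullet> j" "a \<bullet> j \<le> (?q + t *\<^sub>R i) \<bullet> j"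
      by (simp_all add: inner_diff_left inner_add_left)
  qed
  have int_eq: "integral (cbox u v) f = integral K f"
    if "K \<subseteq> cbox u v" "\<And>x. x \<notin> K \<Longrightarrow> f x = 0" for u v and f :: "'a \<Rightarrow> real"
  proof -
    have "(\<lambda>x. if x \<in> cbox u v then f x else 0) = (\<lambda>x. if x \<in> K then f x else 0)"
      using that by (intro ext) auto
    then show ?thesis using integral_restrict_UNIV[of "cbox u v" f] integral_restrict_UNIV[of K f] by simp
  qed
  let ?G = "\<lambda>t. integral (cbox ?p ?q) (\<lambda>x. \<theta> (x + t *\<^sub>R i))"
  have const: "?G t = integral K \<theta>" if "t \<in> {-1..1}" for t
  proof -
    have "?G t = integral (cbox ?p ?q) (\<theta> \<circ> (+) (t *\<^sub>R i))" by (simp add: o_def add.commute)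
    also have "\<dots> = integral (cbox (?p + t *\<^sub>R i) (?q + t *\<^sub>R i)) \<theta>"
      by (rule integral_unique, subst has_integral_shift_cbox_iff)
        (intro integrable_integral integrable_continuous smooth_continuous_on sm)
    also have "\<dots> = integral K \<theta>" by (rule int_eq) (use box[OF that] z in auto)
    finally show ?thesis .
  qed
  have "(?G has_real_derivative integral (cbox ?p ?q) (\<lambda>x. ?d (x + 0 *\<^sub>R i))) (at 0 within {-1..1})"
  proof (rule leibniz_rule_field_derivative)
    fix t x
    have "((\<lambda>t. \<theta> (x + t *\<^sub>R i)) has_derivative (\<lambda>t. frechet_derivative \<theta> (at (x + t' *\<^sub>R i)) (t *\<^sub>R i)))
        (at t' within {-1..1})" for t'
      by (rule has_derivative_compose[OF _ smooth_has_derivative[OF sm]]) (auto intro!: derivative_eq_intros)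
    moreover have "frechet_derivative \<theta> (at y) (t *\<^sub>R i) = ?d y * t" for y t
      using linear_scale[OF has_derivative_linear[OF smooth_has_derivative[OF sm, of y]]] by simp
    ultimately show "((\<lambda>t. \<theta> (x + t *\<^sub>R i)) has_real_derivative ?d (x + t *\<^sub>R i)) (at t within {-1..1})"
      by (simp add: has_field_derivative_def)
    show "(\<lambda>x. \<theta> (x + t *\<^sub>R i)) integrable_on cbox ?p ?q"
      by (intro integrable_continuous continuous_on_compose2[OF smooth_continuous_on[OF sm, of UNIV]] continuous_intros) auto
    show "continuous_on ({- 1..1} \<times> cbox ?p ?q) (\<lambda>(t, x). ?d (x + t *\<^sub>R i))"
      unfolding split_beta by (intro continuous_on_compose2[OF cd[of UNIV]] continuous_intros) auto
  qed auto
  then have "(?G has_real_derivative integral (cbox ?p ?q) ?d) (at 0)"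
    by (simp add: at_within_Icc_at)
  moreover have "(?G has_real_derivative 0) (at 0)"
  proof (rule has_field_derivative_transform_within_open)
    show "((\<lambda>_. integral K \<theta>) has_real_derivative 0) (at 0)" by simp
    show "integral K \<theta> = ?G t" if "t \<in> {-1<..<1}" for t using const[of t] that by simp
  qed auto
  ultimately have "integral (cbox ?p ?q) ?d = 0" by (rule DERIV_unique)
  then have 0: "integral K ?d = 0"
    using int_eq[of ?p ?q ?d] box[of 0] z by simp
  have "integrable (lebesgue_on K) ?d"
    using continuous_locally_integrable[OF cd, of K] K(1) by (simp add: locally_integrable_def)
  then have "(LINT x|lebesgue_on K. ?d x) = 0" using lebesgue_integral_eq_integral s 0 by metis
  then show ?thesis
    using integral_lebesgue_on_zero_ext(2)[OF K(2) s, of ?d] z \<open>open B\<close> by simp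
qed

text \<open>The product \<open>F x * \<psi> x\<close> is a test function, so its partial derivative
  integrates to 0, and the product rule splits that integral into the two sides.\<close>

lemma smooth_integration_by_parts:
  fixes F :: "'a::euclidean_space \<Rightarrow> real"
  assumes F: "smooth F" and \<psi>: "test_function B \<psi>" and B: "open B" and i: "i \<in> Basis"
  shows "(LINT x|lebesgue_on B. F x * frechet_derivative \<psi> (at x) i) =
    - (LINT x|lebesgue_on B. frechet_derivative F (at x) i * \<psi> x)"
proof -
  obtain K where K: "compact K" "K \<subseteq> B" and z: "\<forall>x. x \<notin> K \<longrightarrow> \<psi> x = 0 \<and> (\<forall>i. frechet_derivative \<psi> (at x) i = 0)"
    using test_function_support[OF \<psi>] by blast
  note sm = test_function_smooth[OF \<psi>]
  have i1: "integrable (lebesgue_on B) (\<lambda>x. F x * frechet_derivative \<psi> (at x) i)"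
    by (rule locally_integrable_mult(1)[OF continuous_locally_integrable B _ K])
      (use z in \<open>simp_all add: F sm i smooth_continuous_on smooth_pderiv\<close>)
  have i2: "integrable (lebesgue_on B) (\<lambda>x. frechet_derivative F (at x) i * \<psi> x)"
    by (rule locally_integrable_mult(1)[OF continuous_locally_integrable B _ K])
      (use z in \<open>simp_all add: F sm i smooth_continuous_on smooth_pderiv\<close>)
  show ?thesis
    using integral_pderiv_test_function[OF test_function_mult[OF F \<psi>] B i] i1 i2
    by (simp add: frechet_derivative_mult[OF F sm])
qed

lemma smooth_has_weak_pderiv:
  assumes "smooth F" "open B" "i \<in> Basis"
  shows "has_weak_pderiv B i F (\<lambda>x. frechet_derivative F (at x) i)"
  unfolding has_weak_pderiv_def
  using assms
  by (simp add: smooth_integration_by_parts continuous_locally_integrable smooth_continuous_on smooth_pderiv)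

lemma has_weak_pderiv_diff:
  assumes f: "has_weak_pderiv B i f f'" and g: "has_weak_pderiv B i g g'" and B: "open B" and i: "i \<in> Basis"
  shows "has_weak_pderiv B i (\<lambda>x. f x - g x) (\<lambda>x. f' x - g' x)"
  unfolding has_weak_pderiv_def
proof (intro conjI allI impI)
  have l: "locally_integrable B f" "locally_integrable B f'" "locally_integrable B g" "locally_integrable B g'"
    using f g by (simp_all add: has_weak_pderiv_def)
  then show "locally_integrable B (\<lambda>x. f x - g x)" "locally_integrable B (\<lambda>x. f' x - g' x)"
    by (simp_all add: locally_integrable_def)
  fix \<psi> assume \<psi>: "test_function B \<psi>"
  obtain K where K: "compact K" "K \<subseteq> B" and z: "\<forall>x. x \<notin> K \<longrightarrow> \<psi> x = 0 \<and> (\<forall>i. frechet_derivative \<psi> (at x) i = 0)"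
    using test_function_support[OF \<psi>] by blast
  note sm = test_function_smooth[OF \<psi>]
  have "integrable (lebesgue_on B) (\<lambda>x. h x * \<psi> x)"
    "integrable (lebesgue_on B) (\<lambda>x. h x * frechet_derivative \<psi> (at x) i)"
    if "locally_integrable B h" for h
    by (rule locally_integrable_mult(1)[OF that B _ K];
        use z in \<open>simp add: sm i smooth_continuous_on smooth_pderiv\<close>)+
  then show "(LINT x|lebesgue_on B. (f x - g x) * frechet_derivative \<psi> (at x) i) =
      - (LINT x|lebesgue_on B. (f' x - g' x) * \<psi> x)"
    using f g \<psi> l by (simp add: left_diff_distrib has_weak_pderiv_def)
qed

section \<open>Uniqueness of weak derivatives\<close>

text \<open>The indicator of a box is no test function but a bounded pointwise limit of test
  functions almost everywhere, so dominated convergence with majorant \<open>\<bar>g x\<bar>\<close>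
  transfers the vanishing pairing to it.\<close>

lemma integral_cbox_eq_0:
  fixes g :: "'a::euclidean_space \<Rightarrow> real"
  assumes g: "locally_integrable B g" and B: "open B" and box: "cbox a b \<subseteq> B"
    and 0: "\<And>\<psi>. test_function B \<psi> \<Longrightarrow> (LINT x|lebesgue_on B. g x * \<psi> x) = 0"
  shows "integral (cbox a b) g = 0"
proof -
  let ?M = "lebesgue_on (cbox a b)"
  \<comment> \<open>test functions increasing to the indicator of the open box\<close>
  define \<psi> where "\<psi> n x = 1 - (1 - bump a b x) ^ n" for n x
  have sm: "smooth (\<psi> n)" for n
    unfolding \<psi>_def[abs_def] by (intro smooth_diff smooth_const smooth_power smooth_bump)
  have z: "\<psi> n x = 0" if "x \<notin> cbox a b" for n x
  proof -
    have "x \<notin> box a b" using that box_subset_cbox by blast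
    then show ?thesis by (simp add: \<psi>_def bump_eq_0)
  qed
  have bound: "\<bar>\<psi> n x\<bar> \<le> 1" for n x
    using bump_bounds[of a b x] by (simp add: \<psi>_def power_le_one)
  have lim: "(\<lambda>n. \<psi> n x) \<longlonglongrightarrow> 1" if "x \<in> box a b" for x
  proof -
    have "0 < bump a b x" using that by (simp add: bump_pos_iff)
    then have "(\<lambda>n. (1 - bump a b x) ^ n) \<longlonglongrightarrow> 0"
      using bump_bounds[of a b x] by (intro LIMSEQ_power_zero) simp
    from tendsto_diff[OF tendsto_const[of 1] this] show ?thesis by (simp add: \<psi>_def)
  qed
  have t: "test_function B (\<psi> n)" for n
    using sm compact_cbox box z by (rule test_functionI)
  have gi: "integrable ?M g" using g box by (simp add: locally_integrable_def)
  have "(\<lambda>n. LINT x|?M. g x * \<psi> n x) \<longlonglongrightarrow> (LINT x|?M. g x)"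
  proof (rule integral_dominated_convergence)
    show "g \<in> borel_measurable ?M" "integrable ?M (\<lambda>x. \<bar>g x\<bar>)" using gi by auto
    show "(\<lambda>x. g x * \<psi> n x) \<in> borel_measurable ?M" for n
      by (intro borel_measurable_times borel_measurable_integrable[OF gi] smooth_measurable sm) auto
    \<comment> \<open>On the frontier of the box every \<open>\<psi> n\<close> is 0, so convergence
      to \<open>g x\<close> can fail there; the frontier is a null set.\<close>
    have "cbox a b - box a b \<in> null_sets lebesgue"
      using negligible_frontier_interval negligible_iff_null_sets by blast
    then have "AE x in lebesgue. x \<notin> cbox a b - box a b" by (rule AE_not_in)
    then have "AE x in ?M. x \<in> box a b" by (auto simp: AE_restrict_space_iff elim: eventually_mono)
    then show "AE x in ?M. (\<lambda>n. g x * \<psi> n x) \<longlonglongrightarrow> g x"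
    proof (rule eventually_mono)
      fix x assume "x \<in> box a b"
      from tendsto_mult[OF tendsto_const[of "g x"] lim[OF this]]
      show "(\<lambda>n. g x * \<psi> n x) \<longlonglongrightarrow> g x" by simp
    qed
    show "AE x in ?M. norm (g x * \<psi> n x) \<le> \<bar>g x\<bar>" for n
      using bound[of n] by (intro AE_I2) (simp add: abs_mult mult_left_le)
  qed
  moreover have "(LINT x|?M. g x * \<psi> n x) = 0" for n
  proof -
    have "(LINT x|lebesgue_on B. g x * \<psi> n x) = (LINT x|?M. g x * \<psi> n x)"
      by (rule locally_integrable_mult(3)[OF g B smooth_continuous_on[OF sm] compact_cbox box z])
    then show ?thesis using 0[OF t[of n]] by simp
  qed
  ultimately have "(\<lambda>n::nat. 0) \<longlonglongrightarrow> (LINT x|?M. g x)" by simp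
  then have "(LINT x|?M. g x) = 0" by (simp add: LIMSEQ_const_iff)
  then show ?thesis using lebesgue_integral_eq_integral[OF gi] by simp
qed

text \<open>Lebesgue differentiation: outside a negligible set \<open>g x\<close> is the limit of
  averages over shrinking cubes with corner \<open>x\<close>, and these averages are 0. The argument
  is local to a box, and Lindelof's theorem reduces \<open>B\<close> to countably many
  boxes.\<close>

lemma AE_eq_0_if_integral_cbox_eq_0:
  fixes g :: "'a::euclidean_space \<Rightarrow> real"
  assumes g: "locally_integrable B g" and B: "open B"
    and 0: "\<And>a b. cbox a b \<subseteq> B \<Longrightarrow> integral (cbox a b) g = 0"
  shows "AE x in lebesgue_on B. g x = 0"
proof -
  have neg: "negligible {x \<in> box a b. g x \<noteq> 0}" if box: "cbox a b \<subseteq> B" for a b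
  proof -
    \<comment> \<open>\<open>g\<close> is integrable only on boxes inside \<open>B\<close>. The
      extension by zero is integrable on every \<open>cbox u v\<close>, as the differentiation
      theorem requires, and agrees with \<open>g\<close> near points of
      \<open>box a b\<close>.\<close>
    define f where "f = (\<lambda>x. if x \<in> cbox a b then g x else 0)"
    have "integrable (lebesgue_on (cbox a b)) g"
      using g box by (simp add: locally_integrable_def)
    then have "g integrable_on cbox a b" by (simp add: integrable_on_lebesgue_on)
    then have "f integrable_on UNIV" unfolding f_def by (simp add: integrable_restrict_UNIV)
    then have fi: "f integrable_on cbox u v" for u v by (rule integrable_on_subcbox) simp
    show ?thesis
    proof (rule integrable_ccontinuous_explicit[OF fi])
      fix N assume N: "negligible N" and lim:
        "\<And>x e. \<lbrakk>x \<notin> N; 0 < e\<rbrakk> \<Longrightarrow> \<exists>d>0. \<forall>h. 0 < h \<and> h < d \<longrightarrow>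
           norm (integral (cbox x (x + h *\<^sub>R One)) f /\<^sub>R h ^ DIM('a) - f x) < e"
      have "{x \<in> box a b. g x \<noteq> 0} \<subseteq> N"
      proof (rule subsetI, rule ccontr)
        fix x assume x: "x \<in> {x \<in> box a b. g x \<noteq> 0}" and "x \<notin> N"
        have fx: "f x = g x" using x box_subset_cbox[of a b] by (auto simp: f_def)
        have "0 < \<bar>g x\<bar>" using x by simp
        from lim[OF \<open>x \<notin> N\<close> this] obtain d where "d > 0" and d: "\<forall>h. 0 < h \<and> h < d \<longrightarrow>
           norm (integral (cbox x (x + h *\<^sub>R One)) f /\<^sub>R h ^ DIM('a) - f x) < \<bar>g x\<bar>"
          by (elim exE conjE)
        obtain r where r: "r > 0" "ball x r \<subseteq> box a b"
          using x open_box[of a b] unfolding open_contains_ball by blast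
        \<comment> \<open>The first bound puts \<open>h\<close> within the range of
          \<open>lim\<close>; the second keeps the cube of side \<open>h\<close> inside
          \<open>ball x r\<close>, its diameter being at most \<open>h * DIM('a)\<close> by the sum
          norm.\<close>
        define h where "h = min (d / 2) (r / (2 * DIM('a)))"
        have h: "0 < h" "h < d" "h * DIM('a) < r"
        proof -
          have "h \<le> d / 2" "h \<le> r / (2 * DIM('a))" by (simp_all add: h_def)
          then show "h < d" "h * DIM('a) < r" using \<open>d > 0\<close> r(1) by (simp_all add: field_simps)
          show "0 < h" using \<open>d > 0\<close> r(1) by (simp add: h_def)
        qed
        have sub: "cbox x (x + h *\<^sub>R One) \<subseteq> cbox a b"
        proof
          fix y assume y: "y \<in> cbox x (x + h *\<^sub>R One)"
          have "norm (y - x) \<le> (\<Sum>i\<in>Basis. \<bar>(y - x) \<bullet> i\<bar>)" by (rule norm_le_l1)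
          also have "\<dots> \<le> (\<Sum>i\<in>(Basis::'a set). h)"
          proof (rule sum_mono)
            fix i :: 'a assume "i \<in> Basis"
            then show "\<bar>(y - x) \<bullet> i\<bar> \<le> h"
              using y by (auto simp: mem_box inner_diff_left inner_add_left)
          qed
          also have "\<dots> < r" using h(3) by (simp add: mult.commute)
          finally have "y \<in> ball x r" by (simp add: dist_norm norm_minus_commute)
          then show "y \<in> cbox a b" using r(2) box_subset_cbox by blast
        qed
        have "integral (cbox x (x + h *\<^sub>R One)) f = integral (cbox x (x + h *\<^sub>R One)) g"
          by (rule integral_cong) (use sub in \<open>auto simp: f_def\<close>)
        also have "\<dots> = 0" using sub box by (intro 0) blast
        finally show False using d[rule_format, of h] h(1,2) fx by simp
      qed
      then show "negligible {x \<in> box a b. g x \<noteq> 0}" by (rule negligible_subset[OF N])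
    qed
  qed
  let ?\<F> = "{box a b | a b. cbox a b \<subseteq> B}"
  have cover: "\<Union>?\<F> = B"
  proof
    show "\<Union>?\<F> \<subseteq> B"
      by (auto dest: subsetD[OF box_subset_cbox])
    show "B \<subseteq> \<Union>?\<F>"
    proof
      fix x assume "x \<in> B"
      then obtain a b where "cbox a b \<subseteq> B" "x \<in> box a b"
        by (rule open_contains_cbox[OF B])
      then show "x \<in> \<Union>?\<F>" by blast
    qed
  qed
  obtain \<F> where F: "\<F> \<subseteq> ?\<F>" "countable \<F>" "\<Union>\<F> = \<Union>?\<F>"
    by (rule Lindelof[of ?\<F>]) auto
  have "negligible (\<Union>((\<lambda>S. {x \<in> S. g x \<noteq> 0}) ` \<F>))"
  proof (rule negligible_countable_Union)
    show "countable ((\<lambda>S. {x \<in> S. g x \<noteq> 0}) ` \<F>)" using F(2) by simp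
    fix T assume "T \<in> (\<lambda>S. {x \<in> S. g x \<noteq> 0}) ` \<F>"
    then obtain S where S: "S \<in> \<F>" and T: "T = {x \<in> S. g x \<noteq> 0}" by blast
    from S F(1) obtain a b where "S = box a b" "cbox a b \<subseteq> B" by blast
    then show "negligible T" using neg[of a b] unfolding T by simp
  qed
  moreover have "\<Union>\<F> = B" using F(3) cover by (rule trans)
  then have "\<Union>((\<lambda>S. {x \<in> S. g x \<noteq> 0}) ` \<F>) = {x \<in> B. g x \<noteq> 0}"
    by auto
  ultimately have "{x \<in> B. g x \<noteq> 0} \<in> null_sets lebesgue"
    by (simp add: negligible_iff_null_sets)
  then have "AE x in lebesgue. x \<notin> {x \<in> B. g x \<noteq> 0}" by (rule AE_not_in)
  then have "AE x in lebesgue. x \<in> B \<longrightarrow> g x = 0" by (rule eventually_mono) simp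
  then show ?thesis using B by (simp add: AE_restrict_space_iff)
qed

lemma has_weak_pderiv_unique:
  assumes g: "has_weak_pderiv B i f g" and h: "has_weak_pderiv B i f h" and B: "open B"
  shows "AE x in lebesgue_on B. g x = h x"
proof -
  have lg: "locally_integrable B g" and lh: "locally_integrable B h"
    using g h by (simp_all add: has_weak_pderiv_def)
  then have l: "locally_integrable B (\<lambda>x. g x - h x)"
    by (simp add: locally_integrable_def)
  have "(LINT x|lebesgue_on B. (g x - h x) * \<psi> x) = 0" if \<psi>: "test_function B \<psi>" for \<psi>
  proof -
    obtain K where K: "compact K" "K \<subseteq> B" and z: "\<forall>x. x \<notin> K \<longrightarrow> \<psi> x = 0 \<and> (\<forall>i. frechet_derivative \<psi> (at x) i = 0)"
      using test_function_support[OF \<psi>] by blast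
    note c = smooth_continuous_on[OF test_function_smooth[OF \<psi>]]
    have "integrable (lebesgue_on B) (\<lambda>x. g x * \<psi> x)" "integrable (lebesgue_on B) (\<lambda>x. h x * \<psi> x)"
      using locally_integrable_mult(1)[OF lg B c K] locally_integrable_mult(1)[OF lh B c K] z by simp_all
    then show ?thesis using g h \<psi> by (simp add: left_diff_distrib has_weak_pderiv_def)
  qed
  then have "AE x in lebesgue_on B. g x - h x = 0"
    by (intro AE_eq_0_if_integral_cbox_eq_0[OF l B] integral_cbox_eq_0[OF l B])
  then show ?thesis by simp
qed

lemma weak_pderiv_works:
  "has_weak_pderiv B i f g \<Longrightarrow> has_weak_pderiv B i f (weak_pderiv B i f)"
  unfolding weak_pderiv_def by (rule someI[of "has_weak_pderiv B i f"])

lemma weak_pderiv_unique: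
  "has_weak_pderiv B i f g \<Longrightarrow> open B \<Longrightarrow> AE x in lebesgue_on B. weak_pderiv B i f x = g x"
  using has_weak_pderiv_unique weak_pderiv_works by blast

section \<open>Essentially bounded functions\<close>

lemma LinfI:
  "f \<in> borel_measurable (lebesgue_on B) \<Longrightarrow> AE x in lebesgue_on B. \<bar>f x\<bar> \<le> C \<Longrightarrow> f \<in> Linf B"
  by (auto simp: Linf_def)

lemma Linf_measurable: "f \<in> Linf B \<Longrightarrow> f \<in> borel_measurable (lebesgue_on B)"
  by (simp add: Linf_def)

lemma Linf_bounded:
  assumes "f \<in> Linf B" obtains C where "AE x in lebesgue_on B. \<bar>f x\<bar> \<le> C"
  using assms by (auto simp: Linf_def)

lemma Linf_const: "(\<lambda>_. c) \<in> Linf B"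
  by (rule LinfI[of _ _ "\<bar>c\<bar>"]) auto

lemma Linf_add: assumes "f \<in> Linf B" "g \<in> Linf B" shows "(\<lambda>x. f x + g x) \<in> Linf B"
proof -
  obtain C D where "AE x in lebesgue_on B. \<bar>f x\<bar> \<le> C" "AE x in lebesgue_on B. \<bar>g x\<bar> \<le> D"
    using assms by (auto simp: Linf_def)
  then have "AE x in lebesgue_on B. \<bar>f x + g x\<bar> \<le> C + D" by eventually_elim linarith
  then show ?thesis using assms by (intro LinfI) (simp_all add: Linf_measurable borel_measurable_add borel_measurable_times)
qed

lemma Linf_mult: assumes "f \<in> Linf B" "g \<in> Linf B" shows "(\<lambda>x. f x * g x) \<in> Linf B"
proof -
  obtain C D where "AE x in lebesgue_on B. \<bar>f x\<bar> \<le> C" "AE x in lebesgue_on B. \<bar>g x\<bar> \<le> D"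
    using assms by (auto simp: Linf_def)
  then have "AE x in lebesgue_on B. \<bar>f x * g x\<bar> \<le> C * D"
  proof eventually_elim
    case (elim x)
    moreover from this have "0 \<le> C" by linarith
    ultimately show ?case unfolding abs_mult by (intro mult_mono) auto
  qed
  then show ?thesis using assms by (intro LinfI) (simp_all add: Linf_measurable borel_measurable_add borel_measurable_times)
qed

lemma Linf_sum: "(\<And>i. i \<in> I \<Longrightarrow> f i \<in> Linf B) \<Longrightarrow> (\<lambda>x. \<Sum>i\<in>I. f i x) \<in> Linf B"
  by (induction I rule: infinite_finite_induct) (auto intro: Linf_const Linf_add)

lemma Linf_integrable: "f \<in> Linf B \<Longrightarrow> B \<in> lmeasurable \<Longrightarrow> integrable (lebesgue_on B) f"
  unfolding Linf_def using bounded_integrable_lebesgue_on by blast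

lemma Linf_locally_integrable: "f \<in> Linf B \<Longrightarrow> B \<in> lmeasurable \<Longrightarrow> locally_integrable B f"
  by (simp add: Linf_integrable fmeasurableD integrable_imp_locally_integrable)

lemma continuous_Linf:
  fixes f :: "'a::euclidean_space \<Rightarrow> real"
  assumes "continuous_on UNIV f" "B \<in> sets lebesgue" "bounded B"
  shows "f \<in> Linf B"
proof -
  have "compact (closure B)" using assms(3) by (simp add: compact_closure)
  with assms(1) obtain C where "\<forall>x\<in>closure B. \<bar>f x\<bar> \<le> C" by (rule continuous_bounded_on_compact)
  then show ?thesis
    using assms closure_subset[of B]
    by (intro LinfI[of _ _ C] continuous_measurable_lebesgue_on AE_I2) auto
qed

lemma integral_tendsto_dominated_bounded:
  fixes s :: "nat \<Rightarrow> 'a::euclidean_space \<Rightarrow> real"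
  assumes B: "B \<in> lmeasurable" and s: "\<And>n. s n \<in> borel_measurable (lebesgue_on B)"
    and f: "f \<in> borel_measurable (lebesgue_on B)"
    and w: "w \<in> Linf B" "\<And>n. AE x in lebesgue_on B. \<bar>s n x\<bar> \<le> w x"
    and lim: "AE x in lebesgue_on B. (\<lambda>n. s n x) \<longlonglongrightarrow> f x"
  shows "(\<lambda>n. LINT x|lebesgue_on B. s n x) \<longlonglongrightarrow> (LINT x|lebesgue_on B. f x)"
  by (rule integral_dominated_convergence[OF f s Linf_integrable[OF w(1) B] lim]) (use w(2) in simp)

section \<open>Weak differentiability of Lipschitz functions\<close>

text \<open>Among the smooth functions that are uniformly \<open>1/n\<close>-close to \<open>f\<close> and keep its Lipschitz bound,
  take \<open>F n\<close> almost minimising the \<open>L\<^sup>2\<close>-norm of the \<open>i\<close>-th partial derivative. These sets are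
  convex and decreasing, so by the parallelogram law the derivatives are Cauchy in \<open>L\<^sup>2\<close>.\<close>

lemma lipschitz_smooth_approx_AE:
  fixes f :: "'a::euclidean_space \<Rightarrow> real"
  assumes lip: "L-lipschitz_on UNIV f" and B: "open B" "bounded B" and i: "i \<in> Basis"
  shows "\<exists>F g. (\<forall>n. smooth (F n)) \<and> (\<forall>n. \<forall>x\<in>B. \<bar>F n x - f x\<bar> \<le> inverse (real (Suc n))) \<and>
    (\<forall>n. \<forall>x\<in>B. \<bar>frechet_derivative (F n) (at x) i\<bar> \<le> L) \<and> g \<in> borel_measurable (lebesgue_on B) \<and>
    (AE x in lebesgue_on B. (\<lambda>n. frechet_derivative (F n) (at x) i) \<longlonglongrightarrow> g x)"
proof -
  define M where "M = lebesgue_on B"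
  have Bm: "B \<in> lmeasurable" using B by (simp add: lmeasurable_open)
  then have Bs: "B \<in> sets lebesgue" by (rule fmeasurableD)
  have spM: "space M = B" by (simp add: M_def)
  interpret M: finite_measure M unfolding M_def using Bm by (rule finite_measure_lebesgue_on)
  let ?\<mu> = "measure M (space M)"
  define pd where "pd F x = frechet_derivative F (at x) i" for F :: "'a \<Rightarrow> real" and x :: 'a
  define S where "S n = {F. smooth F \<and> (\<forall>x\<in>B. \<bar>F x - f x\<bar> \<le> inverse (real (Suc n))) \<and> (\<forall>x\<in>B. \<bar>pd F x\<bar> \<le> L)}" for n
  define Q where "Q F = (LINT x|M. (pd F x)\<^sup>2)" for F
  have L: "L \<ge> 0" using lip by (rule lipschitz_on_nonneg)
  have ne: "S n \<noteq> {}" for n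
    using lipschitz_smooth_approx[OF lip B, of "inverse (real (Suc n))"] i by (auto simp: S_def pd_def)
  have anti: "S m \<subseteq> S n" if "n \<le> m" for m n
  proof -
    have "inverse (real (Suc m)) \<le> inverse (real (Suc n))" using that by (simp add: field_simps)
    then show ?thesis unfolding S_def by (blast intro: order_trans)
  qed
  have meas: "pd F \<in> borel_measurable M" if "F \<in> S n" for F n
    using that i Bs unfolding pd_def[abs_def] M_def S_def by (intro smooth_measurable smooth_pderiv) auto
  have bd: "\<bar>pd F x\<bar> \<le> L" if "F \<in> S n" "x \<in> B" for F n x using that by (simp add: S_def)
  have bd2: "(pd F x)\<^sup>2 \<le> L\<^sup>2" if "F \<in> S n" "x \<in> B" for F n x
    using bd[OF that] L by (simp add: abs_le_square_iff[symmetric])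
  have int: "integrable M (pd F)" "integrable M (\<lambda>x. (pd F x)\<^sup>2)" if "F \<in> S n" for F n
    using meas[OF that] bd[OF that] bd2[OF that]
    by (auto intro!: AE_I2 M.integrable_const_bound[where f = "pd F" and B = L]
        M.integrable_const_bound[where f = "\<lambda>x. (pd F x)\<^sup>2" and B = "L\<^sup>2"] simp: spM)
  have Q0: "0 \<le> Q F" for F unfolding Q_def by simp
  have QL: "Q F \<le> L\<^sup>2 * ?\<mu>" if "F \<in> S n" for F n
  proof -
    have "Q F \<le> (LINT x|M. L\<^sup>2)"
      unfolding Q_def using int(2)[OF that] bd2[OF that] by (intro integral_mono) (auto simp: spM)
    then show ?thesis by (simp add: mult.commute)
  qed
  \<comment> \<open>The infima increase because the sets \<open>S n\<close> shrink, and they are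
    bounded by \<open>L\<^sup>2\<close> times the measure of \<open>B\<close>; hence they converge,
    and this is what makes the almost minimisers Cauchy.\<close>
  define a where "a n = Inf (Q ` S n)" for n
  have bb: "bdd_below (Q ` S n)" for n using Q0 by (intro bdd_belowI2[where m = 0])
  have a_le: "a n \<le> Q F" if "F \<in> S n" for F n
    unfolding a_def using bb that by (intro cInf_lower) auto
  have "incseq a"
    unfolding incseq_def a_def using ne bb anti by (intro allI impI cInf_superset_mono image_mono) auto
  moreover have "Bseq a"
  proof (rule BseqI')
    fix n
    obtain F where F: "F \<in> S n" using ne by auto
    have "0 \<le> a n" unfolding a_def using ne Q0 by (intro cInf_greatest) auto
    moreover have "a n \<le> L\<^sup>2 * ?\<mu>" using a_le[OF F] QL[OF F] by linarith
    ultimately show "norm (a n) \<le> L\<^sup>2 * ?\<mu>" by simp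
  qed
  ultimately have "convergent a" by (intro Bseq_monoseq_convergent) (auto simp: incseq_imp_monoseq)
  then have Cau: "Cauchy a" by (simp add: Cauchy_convergent_iff)
  have "\<exists>F. F \<in> S n \<and> Q F < a n + inverse (real (Suc n))" for n
    using cInf_lessD[of "Q ` S n" "a n + inverse (real (Suc n))"] ne[of n] by (auto simp: a_def)
  then obtain F where F: "\<And>n. F n \<in> S n" "\<And>n. Q (F n) < a n + inverse (real (Suc n))" by metis
  \<comment> \<open>For \<open>n \<le> m\<close> both functions lie in \<open>S n\<close>, and so
    does their midpoint \<open>?H\<close>. The parallelogram law expresses the integral through
    \<open>Q (F n)\<close>, \<open>Q (F m)\<close> and \<open>Q ?H\<close>, and \<open>Q ?H\<close>
    is at least \<open>a n\<close>.\<close>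
  have par: "(LINT x|M. (pd (F n) x - pd (F m) x)\<^sup>2) \<le> 2 * (a m - a n) + 2 * inverse (real (Suc n)) + 2 * inverse (real (Suc m))"
    if "n \<le> m" for n m
  proof -
    have Fm: "F m \<in> S n" using F(1) anti[OF that] by blast
    let ?H = "\<lambda>x. 1 / 2 * (F n x + F m x)"
    have sm: "smooth (F n)" "smooth (F m)" using F(1)[of n] F(1)[of m] by (simp_all add: S_def)
    have dH: "pd ?H x = 1 / 2 * (pd (F n) x + pd (F m) x)" for x
      unfolding pd_def frechet_derivative_mult[OF smooth_const smooth_add[OF sm]]
        frechet_derivative_add[OF sm] by simp
    have H: "?H \<in> S n"
      unfolding S_def
    proof (intro CollectI conjI ballI)
      show "smooth ?H" by (intro smooth_mult smooth_const smooth_add sm)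
      fix x assume x: "x \<in> B"
      have "\<bar>F n x - f x\<bar> \<le> inverse (real (Suc n))" "\<bar>F m x - f x\<bar> \<le> inverse (real (Suc n))"
        using F(1)[of n] Fm x by (simp_all add: S_def)
      then show "\<bar>?H x - f x\<bar> \<le> inverse (real (Suc n))" by (simp add: abs_le_iff field_simps)
      show "\<bar>pd ?H x\<bar> \<le> L" unfolding dH using bd[OF F(1)[of n] x] bd[OF Fm x] by simp
    qed
    have "(LINT x|M. (pd (F n) x - pd (F m) x)\<^sup>2)
        = (LINT x|M. 2 * (pd (F n) x)\<^sup>2 + 2 * (pd (F m) x)\<^sup>2 - 4 * (pd ?H x)\<^sup>2)"
      unfolding dH by (rule Bochner_Integration.integral_cong) (auto simp: power2_eq_square algebra_simps)
    also have "\<dots> = 2 * Q (F n) + 2 * Q (F m) - 4 * Q ?H"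
      unfolding Q_def using int(2)[OF F(1)[of n]] int(2)[OF Fm] int(2)[OF H] by simp
    also have "\<dots> \<le> 2 * (a n + inverse (real (Suc n))) + 2 * (a m + inverse (real (Suc m))) - 4 * a n"
      using F(2)[of n] F(2)[of m] a_le[OF H] by (intro diff_mono add_mono mult_left_mono) simp_all
    finally show ?thesis by simp
  qed
  \<comment> \<open>The extraction of an almost everywhere Cauchy subsequence takes a sequence that
    is Cauchy in L1. As \<open>M\<close> is finite, the L2 bound passes to L1 through
    \<open>\<bar>y\<bar> \<le> t + y\<^sup>2 / t\<close>.\<close>
  have L1: "\<exists>N. \<forall>m\<ge>N. \<forall>n\<ge>N. (LINT x|M. norm (pd (F m) x - pd (F n) x)) < e" if "e > 0" for e
  proof -
    define t where "t = e / (2 * (?\<mu> + 1))"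
    have \<mu>: "?\<mu> \<ge> 0" by simp
    have t: "t > 0" "t * ?\<mu> \<le> e / 2"
      using \<open>e > 0\<close> \<mu> by (simp_all add: t_def field_simps add_pos_nonneg)
    \<comment> \<open>The estimate \<open>par\<close> yields at most \<open>6 * \<delta>\<close>,
      two for each of its three summands; divided by \<open>t\<close> this is 3e/8, below the
      \<open>e / 2\<close> that \<open>t * ?\<mu>\<close> leaves.\<close>
    define \<delta> where "\<delta> = t * e / 16"
    have \<delta>: "\<delta> > 0" using t \<open>e > 0\<close> by (simp add: \<delta>_def)
    obtain N1 where N1: "\<forall>m\<ge>N1. \<forall>n\<ge>N1. dist (a m) (a n) < \<delta>"
      using Cau \<delta> unfolding Cauchy_def by blast
    obtain N2 where N2: "inverse (real (Suc N2)) < \<delta>" using reals_Archimedean[OF \<delta>] by blast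
    let ?N = "max N1 N2"
    have main: "(LINT x|M. \<bar>pd (F n) x - pd (F m) x\<bar>) < e" if "?N \<le> n" "n \<le> m" for n m
    proof -
      let ?D = "\<lambda>x. pd (F n) x - pd (F m) x"
      have Fm: "F m \<in> S n" using F(1) anti[OF that(2)] by blast
      have "inverse (real (Suc n)) \<le> inverse (real (Suc N2))" "inverse (real (Suc m)) \<le> inverse (real (Suc N2))"
        using that by (simp_all add: field_simps)
      moreover have "a m - a n < \<delta>" using N1[rule_format, of m n] that by (simp add: dist_real_def)
      moreover have "y < 6 * \<delta>"
        if "p \<le> u" "q \<le> u" "v < \<delta>" "u < \<delta>" "y \<le> 2 * v + 2 * p + 2 * q" for p q u v y
        using that by linarith
      ultimately have D2: "(LINT x|M. (?D x)\<^sup>2) < 6 * \<delta>" using par[OF that(2)] N2 by blast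
      have iD: "integrable M ?D" using int(1)[OF F(1)[of n]] int(1)[OF Fm] by simp
      have iD2: "integrable M (\<lambda>x. (?D x)\<^sup>2)"
      proof (rule M.integrable_const_bound[where B = "(2 * L)\<^sup>2"])
        show "AE x in M. norm ((?D x)\<^sup>2) \<le> (2 * L)\<^sup>2"
        proof (rule AE_I2)
          fix x assume "x \<in> space M"
          then have "\<bar>?D x\<bar> \<le> 2 * L" using bd[OF F(1)[of n], of x] bd[OF Fm, of x] by (simp add: spM)
          from power_mono[OF this, of 2] show "norm ((?D x)\<^sup>2) \<le> (2 * L)\<^sup>2" by simp
        qed
        show "(\<lambda>x. (?D x)\<^sup>2) \<in> borel_measurable M" using iD by simp
      qed
      have "\<bar>?D x\<bar> \<le> t + (?D x)\<^sup>2 / t" for x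
      proof -
        have "0 \<le> (\<bar>?D x\<bar> - t)\<^sup>2 + t * \<bar>?D x\<bar>" using t by simp
        then have "\<bar>?D x\<bar> * t \<le> t * t + (?D x)\<^sup>2" by (simp add: power2_eq_square algebra_simps)
        then show ?thesis using t by (simp add: field_simps)
      qed
      then have "(LINT x|M. \<bar>?D x\<bar>) \<le> (LINT x|M. t + (?D x)\<^sup>2 / t)"
        using iD iD2 by (intro integral_mono) auto
      also have "\<dots> = t * ?\<mu> + (LINT x|M. (?D x)\<^sup>2) / t" using iD2 by simp
      also have "(LINT x|M. (?D x)\<^sup>2) / t < 6 * \<delta> / t" using D2 t by (simp add: divide_strict_right_mono)
      also have "6 * \<delta> / t \<le> e / 2" using t \<open>e > 0\<close> by (simp add: \<delta>_def)
      finally show ?thesis using t by linarith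
    qed
    have "(LINT x|M. norm (pd (F m) x - pd (F n) x)) < e" if "m \<ge> ?N" "n \<ge> ?N" for m n
    proof (cases "n \<le> m")
      case True
      then show ?thesis using main[of n m] that by (simp add: abs_minus_commute)
    next
      case False
      then show ?thesis using main[of m n] that by simp
    qed
    then show ?thesis by (intro exI[of _ ?N] allI impI)
  qed
  obtain r where r: "strict_mono r" "AE x in M. Cauchy (\<lambda>n. pd (F (r n)) x)"
    by (rule cauchy_L1_AE_cauchy_subseq[of M "\<lambda>n. pd (F n)", OF int(1)[OF F(1)] L1])
  \<comment> \<open>Where the sequence diverges, which happens only on a null set,
    \<open>lim\<close> is an unspecified value; the pointwise \<open>lim\<close> is measurable all
    the same.\<close>
  define g where "g x = lim (\<lambda>n. pd (F (r n)) x)" for x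
  show ?thesis
  proof (intro exI[of _ "\<lambda>n. F (r n)"] exI[of _ g] conjI allI)
    \<comment> \<open>A subsequence keeps the \<open>n\<close>-th bounds, because
      \<open>n \<le> r n\<close> and the sets \<open>S n\<close> decrease.\<close>
    have Sr: "F (r n) \<in> S n" for n using F(1) anti[OF seq_suble[OF r(1)]] by blast
    show "smooth (F (r n))" "\<forall>x\<in>B. \<bar>F (r n) x - f x\<bar> \<le> inverse (real (Suc n))"
      "\<forall>x\<in>B. \<bar>frechet_derivative (F (r n)) (at x) i\<bar> \<le> L" for n
      using Sr[of n] by (simp_all add: S_def pd_def)
    have "pd (F (r n)) \<in> borel_measurable M" for n using meas[OF F(1)] .
    then show "g \<in> borel_measurable (lebesgue_on B)"
      unfolding g_def[abs_def] M_def[symmetric] by (rule borel_measurable_lim_metric)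
    show "AE x in lebesgue_on B. (\<lambda>n. frechet_derivative (F (r n)) (at x) i) \<longlonglongrightarrow> g x"
      using r(2) unfolding M_def[symmetric]
    proof (rule eventually_mono)
      fix x assume "Cauchy (\<lambda>n. pd (F (r n)) x)"
      then show "(\<lambda>n. frechet_derivative (F (r n)) (at x) i) \<longlonglongrightarrow> g x"
        unfolding g_def pd_def Cauchy_convergent_iff convergent_LIMSEQ_iff .
    qed
  qed
qed

text \<open>The function \<open>g\<close> is chosen before \<open>c\<close>: with
  \<open>c = 1\<close> it is a weak derivative of \<open>f\<close>, and the same \<open>g\<close>
  then occurs in the product with any bounded \<open>c\<close>. The proof tests the weak derivative
  of \<open>c\<close> against \<open>F n x * \<psi> x\<close> and lets \<open>n\<close> grow, so
  \<open>c\<close> itself is never approximated.\<close>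

lemma lipschitz_pderiv_product_rule:
  fixes f :: "'a::euclidean_space \<Rightarrow> real"
  assumes lip: "L-lipschitz_on UNIV f" and B: "open B" "bounded B" and i: "i \<in> Basis"
  shows "\<exists>g\<in>Linf B. \<forall>c\<in>Linf B. \<forall>c'\<in>Linf B. has_weak_pderiv B i c c' \<longrightarrow>
    has_weak_pderiv B i (\<lambda>x. c x * f x) (\<lambda>x. c' x * f x + c x * g x)"
proof -
  have Bm: "B \<in> lmeasurable" using B by (simp add: lmeasurable_open)
  then have Bs: "B \<in> sets lebesgue" by (rule fmeasurableD)
  obtain F g where sm: "\<forall>n. smooth (F n)" and close: "\<forall>n. \<forall>x\<in>B. \<bar>F n x - f x\<bar> \<le> inverse (real (Suc n))"
    and bd: "\<forall>n. \<forall>x\<in>B. \<bar>frechet_derivative (F n) (at x) i\<bar> \<le> L"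
    and g: "g \<in> borel_measurable (lebesgue_on B)"
    and lim: "AE x in lebesgue_on B. (\<lambda>n. frechet_derivative (F n) (at x) i) \<longlonglongrightarrow> g x"
    using lipschitz_smooth_approx_AE[OF lip B i] by (elim exE conjE)
  have inB: "AE x in lebesgue_on B. x \<in> B" by (rule AE_I2) simp
  have "AE x in lebesgue_on B. \<bar>g x\<bar> \<le> L"
    using lim inB
  proof eventually_elim
    case (elim x)
    show ?case by (rule LIMSEQ_le_const2[OF tendsto_rabs[OF elim(1)]]) (use bd elim(2) in blast)
  qed
  with g have gL: "g \<in> Linf B" by (rule LinfI)
  have fL: "f \<in> Linf B"
    using lipschitz_on_continuous_on[OF lip] Bs B(2) by (rule continuous_Linf)
  have Flim: "(\<lambda>n. F n x) \<longlonglongrightarrow> f x" if "x \<in> B" for x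
  proof (rule LIM_zero_cancel, rule Lim_null_comparison)
    show "\<forall>\<^sub>F n in sequentially. norm (F n x - f x) \<le> inverse (real (Suc n))" using close that by simp
  qed (rule LIMSEQ_inverse_real_of_nat)
  show ?thesis
  proof (intro bexI[OF _ gL] ballI impI)
    fix c c' assume c: "c \<in> Linf B" "c' \<in> Linf B" and wd: "has_weak_pderiv B i c c'"
    show "has_weak_pderiv B i (\<lambda>x. c x * f x) (\<lambda>x. c' x * f x + c x * g x)"
      unfolding has_weak_pderiv_def
    proof (intro conjI allI impI)
      show "locally_integrable B (\<lambda>x. c x * f x)" "locally_integrable B (\<lambda>x. c' x * f x + c x * g x)"
        using c fL gL Bm by (auto intro!: Linf_locally_integrable Linf_mult Linf_add)
      fix \<psi> assume \<psi>: "test_function B \<psi>"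
      let ?d = "\<lambda>\<psi> x. frechet_derivative \<psi> (at x) i"
      note s\<psi> = test_function_smooth[OF \<psi>]
      have \<psi>L: "\<psi> \<in> Linf B" "?d \<psi> \<in> Linf B"
        using s\<psi> i Bs B(2) by (auto intro!: continuous_Linf smooth_continuous_on smooth_pderiv)
      have eq: "(LINT x|lebesgue_on B. c x * (F n x * ?d \<psi> x + ?d (F n) x * \<psi> x))
          = - (LINT x|lebesgue_on B. c' x * (F n x * \<psi> x))" for n
      proof -
        have "test_function B (\<lambda>x. F n x * \<psi> x)" using sm \<psi> by (simp add: test_function_mult)
        then have "(LINT x|lebesgue_on B. c x * ?d (\<lambda>x. F n x * \<psi> x) x)
          = - (LINT x|lebesgue_on B. c' x * (F n x * \<psi> x))"
          using wd by (simp add: has_weak_pderiv_def)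
        then show ?thesis using sm s\<psi> by (simp add: frechet_derivative_mult)
      qed
      note [measurable] = c[THEN Linf_measurable] fL[THEN Linf_measurable] gL[THEN Linf_measurable]
        \<psi>L[THEN Linf_measurable]
      have [measurable]: "F n \<in> borel_measurable (lebesgue_on B)" "?d (F n) \<in> borel_measurable (lebesgue_on B)" for n
        using sm i Bs by (auto intro!: smooth_measurable smooth_pderiv)
      have absL: "h \<in> Linf B \<Longrightarrow> (\<lambda>x. \<bar>h x\<bar>) \<in> Linf B" for h
        by (auto simp: Linf_def)
      \<comment> \<open>A bound uniform in \<open>n\<close>, needed for the majorants; the 1 is the
        largest value of \<open>inverse (real (Suc n))\<close>.\<close>
      have Fb: "\<bar>F n x\<bar> \<le> \<bar>f x\<bar> + 1" if "x \<in> B" for n x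
      proof -
        have "\<bar>F n x - f x\<bar> \<le> inverse (real (Suc n))" using close that by blast
        also have "\<dots> \<le> 1" by (simp add: field_simps)
        finally show ?thesis by linarith
      qed
      have "(\<lambda>n. LINT x|lebesgue_on B. c x * (F n x * ?d \<psi> x + ?d (F n) x * \<psi> x))
          \<longlonglongrightarrow> (LINT x|lebesgue_on B. c x * (f x * ?d \<psi> x + g x * \<psi> x))"
      proof (rule integral_tendsto_dominated_bounded[OF Bm,
            where w = "\<lambda>x. \<bar>c x\<bar> * ((\<bar>f x\<bar> + 1) * \<bar>?d \<psi> x\<bar> + L * \<bar>\<psi> x\<bar>)"])
        show "(\<lambda>x. \<bar>c x\<bar> * ((\<bar>f x\<bar> + 1) * \<bar>?d \<psi> x\<bar> + L * \<bar>\<psi> x\<bar>)) \<in> Linf B"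
          using c fL \<psi>L by (intro Linf_mult Linf_add absL Linf_const)
        show "AE x in lebesgue_on B. \<bar>c x * (F n x * ?d \<psi> x + ?d (F n) x * \<psi> x)\<bar>
            \<le> \<bar>c x\<bar> * ((\<bar>f x\<bar> + 1) * \<bar>?d \<psi> x\<bar> + L * \<bar>\<psi> x\<bar>)" for n
        proof (rule AE_I2)
          fix x assume "x \<in> space (lebesgue_on B)"
          then have x: "x \<in> B" by simp
          have "\<bar>F n x * ?d \<psi> x + ?d (F n) x * \<psi> x\<bar> \<le> \<bar>F n x * ?d \<psi> x\<bar> + \<bar>?d (F n) x * \<psi> x\<bar>"
            by (rule abs_triangle_ineq)
          also have "\<dots> \<le> (\<bar>f x\<bar> + 1) * \<bar>?d \<psi> x\<bar> + L * \<bar>\<psi> x\<bar>"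
            unfolding abs_mult using Fb[OF x] bd x by (intro add_mono mult_right_mono) auto
          finally show "\<bar>c x * (F n x * ?d \<psi> x + ?d (F n) x * \<psi> x)\<bar>
            \<le> \<bar>c x\<bar> * ((\<bar>f x\<bar> + 1) * \<bar>?d \<psi> x\<bar> + L * \<bar>\<psi> x\<bar>)"
            unfolding abs_mult[of "c x"] by (rule mult_left_mono) simp
        qed
        show "AE x in lebesgue_on B. (\<lambda>n. c x * (F n x * ?d \<psi> x + ?d (F n) x * \<psi> x))
            \<longlonglongrightarrow> c x * (f x * ?d \<psi> x + g x * \<psi> x)"
          using lim inB by eventually_elim (intro tendsto_intros Flim)
      qed measurable
      moreover have "(\<lambda>n. - (LINT x|lebesgue_on B. c' x * (F n x * \<psi> x)))
          \<longlonglongrightarrow> - (LINT x|lebesgue_on B. c' x * (f x * \<psi> x))"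
      proof (rule tendsto_minus, rule integral_tendsto_dominated_bounded[OF Bm,
            where w = "\<lambda>x. \<bar>c' x\<bar> * ((\<bar>f x\<bar> + 1) * \<bar>\<psi> x\<bar>)"])
        show "(\<lambda>x. \<bar>c' x\<bar> * ((\<bar>f x\<bar> + 1) * \<bar>\<psi> x\<bar>)) \<in> Linf B"
          using c fL \<psi>L by (intro Linf_mult Linf_add absL Linf_const)
        show "AE x in lebesgue_on B. \<bar>c' x * (F n x * \<psi> x)\<bar> \<le> \<bar>c' x\<bar> * ((\<bar>f x\<bar> + 1) * \<bar>\<psi> x\<bar>)" for n
          unfolding abs_mult using Fb by (intro AE_I2 mult_left_mono mult_right_mono) auto
        show "AE x in lebesgue_on B. (\<lambda>n. c' x * (F n x * \<psi> x)) \<longlonglongrightarrow> c' x * (f x * \<psi> x)"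
          using inB by eventually_elim (intro tendsto_intros Flim)
      qed measurable
      ultimately have lim_eq: "(LINT x|lebesgue_on B. c x * (f x * ?d \<psi> x + g x * \<psi> x))
          = - (LINT x|lebesgue_on B. c' x * (f x * \<psi> x))"
        unfolding eq by (rule LIMSEQ_unique)
      have I: "integrable (lebesgue_on B) (\<lambda>x. c x * f x * ?d \<psi> x)"
        "integrable (lebesgue_on B) (\<lambda>x. c x * g x * \<psi> x)"
        "integrable (lebesgue_on B) (\<lambda>x. c' x * f x * \<psi> x)"
        using c fL gL \<psi>L Bm by (intro Linf_integrable Linf_mult; simp)+
      show "(LINT x|lebesgue_on B. c x * f x * ?d \<psi> x)
          = - (LINT x|lebesgue_on B. (c' x * f x + c x * g x) * \<psi> x)"
        using lim_eq I by (simp add: distrib_left distrib_right mult.assoc)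
    qed
  qed
qed

section \<open>Square integrable functions\<close>

text \<open>Completeness of Lebesgue measure, brought to \<open>B\<close> through extension by zero.
  It makes the chosen representative \<open>weak_pderiv\<close> measurable, since it is known only
  up to a null set.\<close>

lemma borel_measurable_lebesgue_on_AE:
  fixes f g :: "'a::euclidean_space \<Rightarrow> real"
  assumes f: "f \<in> borel_measurable (lebesgue_on B)" and B: "B \<in> sets lebesgue"
    and eq: "AE x in lebesgue_on B. f x = g x"
  shows "g \<in> borel_measurable (lebesgue_on B)"
proof -
  have "AE x in lebesgue. x \<in> B \<longrightarrow> f x = g x"
    using eq B by (simp add: AE_restrict_space_iff)
  then have "AE x in lebesgue. (if x \<in> B then f x else 0) = (if x \<in> B then g x else 0)"
    by (rule eventually_mono) simp
  with borel_measurable_if[OF B, THEN iffD2, OF f]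
  have "(\<lambda>x. if x \<in> B then g x else 0) \<in> borel_measurable lebesgue"
    by (rule borel_measurable_AE)
  then show ?thesis by (rule borel_measurable_if[OF B, THEN iffD1])
qed

lemma L2_measurable: "f \<in> L2 B \<Longrightarrow> f \<in> borel_measurable (lebesgue_on B)"
  by (simp add: L2_def)

lemma L2_AE_eq:
  assumes f: "f \<in> L2 B" and B: "B \<in> sets lebesgue" and eq: "AE x in lebesgue_on B. f x = g x"
  shows "g \<in> L2 B"
proof -
  have g: "g \<in> borel_measurable (lebesgue_on B)"
    using L2_measurable[OF f] B eq by (rule borel_measurable_lebesgue_on_AE)
  have "AE x in lebesgue_on B. (f x)\<^sup>2 = (g x)\<^sup>2" using eq by eventually_elim simp
  then have "integrable (lebesgue_on B) (\<lambda>x. (f x)\<^sup>2) \<longleftrightarrow> integrable (lebesgue_on B) (\<lambda>x. (g x)\<^sup>2)"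
    by (intro integrable_cong_AE borel_measurable_power g L2_measurable[OF f])
  with f g show ?thesis by (simp add: L2_def)
qed

lemma Linf_AE_eq:
  assumes f: "f \<in> Linf B" and B: "B \<in> sets lebesgue" and eq: "AE x in lebesgue_on B. f x = g x"
  shows "g \<in> Linf B"
proof -
  obtain C where C: "AE x in lebesgue_on B. \<bar>f x\<bar> \<le> C" using f by (rule Linf_bounded)
  have "AE x in lebesgue_on B. \<bar>g x\<bar> \<le> C" using C eq by eventually_elim simp
  then show ?thesis
    using borel_measurable_lebesgue_on_AE[OF Linf_measurable[OF f] B eq] by (intro LinfI)
qed

lemma L2_integrable_mult:
  assumes "f \<in> L2 B" "g \<in> L2 B"
  shows "integrable (lebesgue_on B) (\<lambda>x. f x * g x)"
proof (rule Bochner_Integration.integrable_bound)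
  show "integrable (lebesgue_on B) (\<lambda>x. (f x)\<^sup>2 + (g x)\<^sup>2)" using assms by (simp add: L2_def)
  show "(\<lambda>x. f x * g x) \<in> borel_measurable (lebesgue_on B)"
    using assms by (simp add: L2_measurable borel_measurable_times)
  have "\<bar>a * b\<bar> \<le> a\<^sup>2 + b\<^sup>2" for a b :: real
  proof -
    have "2 * \<bar>a * b\<bar> \<le> a\<^sup>2 + b\<^sup>2"
      using sum_squares_bound[of "\<bar>a\<bar>" "\<bar>b\<bar>"] by (simp add: abs_mult)
    then show ?thesis using abs_ge_zero[of "a * b"] by linarith
  qed
  then show "AE x in lebesgue_on B. norm (f x * g x) \<le> norm ((f x)\<^sup>2 + (g x)\<^sup>2)" by (intro AE_I2) simp
qed

lemma L2_diff:
  assumes f: "f \<in> L2 B" and g: "g \<in> L2 B" shows "(\<lambda>x. f x - g x) \<in> L2 B"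
proof -
  have "integrable (lebesgue_on B) (\<lambda>x. (f x)\<^sup>2 + (g x)\<^sup>2 - 2 * (f x * g x))"
    using f g L2_integrable_mult[OF f g] by (simp add: L2_def)
  then show ?thesis
    using f g by (simp add: L2_def borel_measurable_diff power2_diff algebra_simps)
qed

lemma Linf_mult_integrable:
  "c \<in> Linf B \<Longrightarrow> integrable (lebesgue_on B) f \<Longrightarrow> integrable (lebesgue_on B) (\<lambda>x. c x * f x)"
  unfolding Linf_def using integrable_bounded_mult[of "lebesgue_on B" f c] by (auto simp: mult.commute)

lemma continuous_L2:
  fixes f :: "'a::euclidean_space \<Rightarrow> real"
  assumes "continuous_on UNIV f" "B \<in> lmeasurable" "bounded B"
  shows "f \<in> L2 B"
proof -
  have f: "f \<in> Linf B" using assms by (intro continuous_Linf) (auto simp: fmeasurableD)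
  show ?thesis
    using Linf_integrable[OF Linf_mult[OF f f] assms(2)] f
    by (simp add: L2_def Linf_measurable power2_eq_square)
qed

text \<open>A weighted Young inequality with free weight \<open>s\<close> replaces Cauchy-Schwarz:
  first \<open>s\<close> is made small against the norms of the limits \<open>a\<close> and
  \<open>b\<close>, then \<open>k\<close> is taken large so that the squared errors
  \<open>E k\<close> outweigh the factor \<open>1 / s + 1\<close>.\<close>

lemma L2_integral_mult_tendsto:
  fixes a b :: "'a::euclidean_space \<Rightarrow> real"
  assumes a: "a \<in> L2 B" "\<And>k. as k \<in> L2 B" "(\<lambda>k. LINT x|lebesgue_on B. (a x - as k x)\<^sup>2) \<longlonglongrightarrow> 0"
    and b: "b \<in> L2 B" "\<And>k. bs k \<in> L2 B" "(\<lambda>k. LINT x|lebesgue_on B. (b x - bs k x)\<^sup>2) \<longlonglongrightarrow> 0"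
    and c: "c \<in> Linf B"
  shows "(\<lambda>k. LINT x|lebesgue_on B. c x * (as k x * bs k x)) \<longlonglongrightarrow> (LINT x|lebesgue_on B. c x * (a x * b x))"
proof -
  let ?M = "lebesgue_on B"
  obtain C0 where C0: "AE x in ?M. \<bar>c x\<bar> \<le> C0" using c by (rule Linf_bounded)
  define C where "C = \<bar>C0\<bar> + 1"
  have C: "C > 0" "AE x in ?M. \<bar>c x\<bar> \<le> C"
    using C0 by (auto simp: C_def elim!: eventually_mono)
  define S where "S = (LINT x|?M. (a x)\<^sup>2) + (LINT x|?M. (b x)\<^sup>2)"
  have S: "S \<ge> 0" unfolding S_def by simp
  define E where "E k = (LINT x|?M. (a x - as k x)\<^sup>2) + (LINT x|?M. (b x - bs k x)\<^sup>2)" for k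
  have E: "E \<longlonglongrightarrow> 0" unfolding E_def[abs_def] using tendsto_add[OF a(3) b(3)] by simp
  have ia: "integrable ?M (\<lambda>x. (a x)\<^sup>2)" "integrable ?M (\<lambda>x. (a x - as k x)\<^sup>2)"
    and ib: "integrable ?M (\<lambda>x. (b x)\<^sup>2)" "integrable ?M (\<lambda>x. (b x - bs k x)\<^sup>2)" for k
    using a(1) L2_diff[OF a(1,2)] b(1) L2_diff[OF b(1,2)] by (simp_all add: L2_def)
  have iab: "integrable ?M (\<lambda>x. c x * (a x * b x))" "integrable ?M (\<lambda>x. c x * (as k x * bs k x))" for k
    by (intro Linf_mult_integrable[OF c] L2_integrable_mult a b)+
  have est: "\<bar>(LINT x|?M. c x * (as k x * bs k x)) - (LINT x|?M. c x * (a x * b x))\<bar>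
      \<le> C * (s * S + (1 / s + 1) * E k)" if "s > 0" for s k
  proof -
    have pt: "\<bar>p' * q' - p * q\<bar> \<le> s * (p\<^sup>2 + q\<^sup>2) + (1 / s + 1) * ((p - p')\<^sup>2 + (q - q')\<^sup>2)" for p q p' q' :: real
    proof -
      have am: "\<bar>x * y\<bar> \<le> s * x\<^sup>2 + 1 / s * y\<^sup>2" for x y :: real
      proof -
        have "0 \<le> (s * \<bar>x\<bar> - \<bar>y\<bar>)\<^sup>2 + s * (\<bar>x\<bar> * \<bar>y\<bar>)" using that by simp
        then have "s * \<bar>x * y\<bar> \<le> s * (s * x\<^sup>2 + 1 / s * y\<^sup>2)"
          using that by (simp add: power2_diff power_mult_distrib abs_mult algebra_simps power2_eq_square)
        then show ?thesis using that by (simp only: mult_le_cancel_left_pos)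
      qed
      have sq: "\<bar>x * y\<bar> \<le> x\<^sup>2 + y\<^sup>2" for x y :: real
      proof -
        have "2 * \<bar>x * y\<bar> \<le> x\<^sup>2 + y\<^sup>2"
          using sum_squares_bound[of "\<bar>x\<bar>" "\<bar>y\<bar>"] by (simp add: abs_mult)
        then show ?thesis using abs_ge_zero[of "x * y"] by linarith
      qed
      \<comment> \<open>Every term has a difference as a factor, and the remaining factors are the
        limits \<open>p\<close>, \<open>q\<close> or another difference. Hence no uniform bound on
        the approximating sequences enters.\<close>
      have "p' * q' - p * q = (p - p') * (q - q') - p * (q - q') - q * (p - p')" by (simp add: algebra_simps)
      then have "\<bar>p' * q' - p * q\<bar> \<le> \<bar>(p - p') * (q - q')\<bar> + \<bar>p * (q - q')\<bar> + \<bar>q * (p - p')\<bar>" by linarith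
      also have "\<dots> \<le> ((p - p')\<^sup>2 + (q - q')\<^sup>2) + (s * p\<^sup>2 + 1 / s * (q - q')\<^sup>2) + (s * q\<^sup>2 + 1 / s * (p - p')\<^sup>2)"
        by (intro add_mono sq am)
      finally show ?thesis by (simp add: algebra_simps)
    qed
    have "\<bar>(LINT x|?M. c x * (as k x * bs k x)) - (LINT x|?M. c x * (a x * b x))\<bar>
        = \<bar>LINT x|?M. c x * (as k x * bs k x) - c x * (a x * b x)\<bar>"
      using iab by simp
    also have "\<dots> \<le> (LINT x|?M. \<bar>c x * (as k x * bs k x) - c x * (a x * b x)\<bar>)"
      by (rule integral_abs_bound)
    also have "\<dots> \<le> (LINT x|?M. C * (s * ((a x)\<^sup>2 + (b x)\<^sup>2) + (1 / s + 1) * ((a x - as k x)\<^sup>2 + (b x - bs k x)\<^sup>2)))"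
    proof (rule integral_mono_AE)
      show "integrable ?M (\<lambda>x. \<bar>c x * (as k x * bs k x) - c x * (a x * b x)\<bar>)" using iab by simp
      show "integrable ?M (\<lambda>x. C * (s * ((a x)\<^sup>2 + (b x)\<^sup>2) + (1 / s + 1) * ((a x - as k x)\<^sup>2 + (b x - bs k x)\<^sup>2)))"
        using ia ib by simp
      show "AE x in ?M. \<bar>c x * (as k x * bs k x) - c x * (a x * b x)\<bar>
        \<le> C * (s * ((a x)\<^sup>2 + (b x)\<^sup>2) + (1 / s + 1) * ((a x - as k x)\<^sup>2 + (b x - bs k x)\<^sup>2))"
        using C(2)
      proof (rule eventually_mono)
        fix x assume "\<bar>c x\<bar> \<le> C"
        then show "\<bar>c x * (as k x * bs k x) - c x * (a x * b x)\<bar>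
          \<le> C * (s * ((a x)\<^sup>2 + (b x)\<^sup>2) + (1 / s + 1) * ((a x - as k x)\<^sup>2 + (b x - bs k x)\<^sup>2))"
          unfolding right_diff_distrib[symmetric] abs_mult[of "c x"] using C(1)
          by (intro mult_mono pt) auto
      qed
    qed
    also have "\<dots> = C * (s * S + (1 / s + 1) * E k)"
      using ia ib by (simp add: S_def E_def)
    finally show ?thesis .
  qed
  show ?thesis
  proof (rule LIM_zero_cancel, rule tendstoI)
    fix e :: real assume e: "e > 0"
    \<comment> \<open>Gives \<open>C * (s * (S + 1)) = e / 2\<close>; the 1 in \<open>S + 1\<close>,
      like the one in \<open>C\<close>, keeps the denominator positive.\<close>
    define s where "s = e / (2 * C * (S + 1))"
    have S1: "S + 1 > 0" using S by simp
    have "s > 0" unfolding s_def using e C(1) S1 by simp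
    moreover have "C * (s * S) \<le> C * (s * (S + 1))"
      using \<open>s > 0\<close> C(1) by simp
    moreover have "C * (s * (S + 1)) = e / 2"
      using C(1) S1 by (simp add: s_def)
    ultimately have s: "s > 0" "C * (s * S) \<le> e / 2" by linarith+
    have "(\<lambda>k. C * ((1 / s + 1) * E k)) \<longlonglongrightarrow> C * ((1 / s + 1) * 0)" by (intro tendsto_intros E)
    then have "\<forall>\<^sub>F k in sequentially. C * ((1 / s + 1) * E k) < e / 2"
      using e by (intro order_tendstoD(2)) auto
    then show "\<forall>\<^sub>F k in sequentially. dist ((LINT x|?M. c x * (as k x * bs k x)) - (LINT x|?M. c x * (a x * b x))) 0 < e"
    proof (rule eventually_mono)
      fix k assume k: "C * ((1 / s + 1) * E k) < e / 2"
      have "C * (s * S + (1 / s + 1) * E k) = C * (s * S) + C * ((1 / s + 1) * E k)"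
        by (rule distrib_left)
      with k s(2) est[OF s(1), of k]
      show "dist ((LINT x|?M. c x * (as k x * bs k x)) - (LINT x|?M. c x * (a x * b x))) 0 < e"
        unfolding dist_real_def diff_0_right by linarith
    qed
  qed
qed

section \<open>Integration by parts in \<open>H\<^sup>1\<^sub>0\<close>\<close>

text \<open>\<open>H1\<close> provides some square integrable weak derivative; uniqueness passes
  square integrability on to the representative picked by \<open>weak_pderiv\<close>.\<close>

lemma H1_weak_pderiv:
  assumes u: "u \<in> H1 B" and B: "open B" and i: "i \<in> Basis"
  shows "weak_pderiv B i u \<in> L2 B" "has_weak_pderiv B i u (weak_pderiv B i u)"
proof -
  obtain g where g: "g \<in> L2 B" "has_weak_pderiv B i u g" using u i by (auto simp: H1_def)
  then show "has_weak_pderiv B i u (weak_pderiv B i u)" using weak_pderiv_works by blast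
  have "AE x in lebesgue_on B. g x = weak_pderiv B i u x"
    using weak_pderiv_unique[OF g(2) B] by (rule eventually_mono) simp
  with g(1) _ show "weak_pderiv B i u \<in> L2 B" by (rule L2_AE_eq) (use B in auto)
qed

lemma weak_pderiv_Linf:
  assumes "has_weak_pderiv B i f g" "g \<in> Linf B" "open B"
  shows "weak_pderiv B i f \<in> Linf B"
proof -
  have "AE x in lebesgue_on B. g x = weak_pderiv B i f x"
    using weak_pderiv_unique[OF assms(1,3)] by (rule eventually_mono) simp
  with assms(2) _ show ?thesis by (rule Linf_AE_eq) (use assms in auto)
qed

lemma weak_grad_inner: "i \<in> Basis \<Longrightarrow> weak_grad B f x \<bullet> i = weak_pderiv B i f x"
  by (simp add: weak_grad_def inner_sum_left_Basis)

lemma inner_weak_grad: "v \<bullet> weak_grad B f x = (\<Sum>i\<in>Basis. (v \<bullet> i) * weak_pderiv B i f x)"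
  by (subst euclidean_inner) (simp add: weak_grad_inner)

lemma norm_weak_grad: "(norm (weak_grad B f x))\<^sup>2 = (\<Sum>i\<in>Basis. (weak_pderiv B i f x)\<^sup>2)"
  unfolding power2_norm_eq_inner inner_weak_grad by (simp add: weak_grad_inner power2_eq_square)

text \<open>\<open>H1_norm\<close> refers to the chosen weak gradient of the difference
  \<open>u x - \<psi> k x\<close>. Uniqueness splits it almost everywhere into the derivative of
  \<open>u\<close> minus the classical one of \<open>\<psi> k\<close>; the squared norm is then a
  sum of nonnegative integrals, each squeezed to 0.\<close>

lemma H10_approx:
  assumes u: "u \<in> H10 B" and B: "open B" "bounded B"
  shows "\<exists>\<psi>. (\<forall>k. test_function B (\<psi> k)) \<and> (\<lambda>k. LINT x|lebesgue_on B. (u x - \<psi> k x)\<^sup>2) \<longlonglongrightarrow> 0 \<and>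
    (\<forall>i\<in>Basis. (\<lambda>k. LINT x|lebesgue_on B. (weak_pderiv B i u x - frechet_derivative (\<psi> k) (at x) i)\<^sup>2) \<longlonglongrightarrow> 0)"
proof -
  let ?M = "lebesgue_on B"
  have Bm: "B \<in> lmeasurable" using B by (simp add: lmeasurable_open)
  have u1: "u \<in> H1 B" and uL: "u \<in> L2 B" using u by (auto simp: H10_def H1_def)
  obtain \<psi> where \<psi>: "\<forall>k. test_function B (\<psi> k)" and lim: "(\<lambda>k. H1_norm B (\<lambda>x. u x - \<psi> k x)) \<longlonglongrightarrow> 0"
    using u by (auto simp: H10_def)
  have sm: "smooth (\<psi> k)" for k using \<psi> by (blast intro: test_function_smooth)
  let ?d = "\<lambda>i k x. weak_pderiv B i u x - frechet_derivative (\<psi> k) (at x) i"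
  have dL: "?d i k \<in> L2 B" if "i \<in> Basis" for i k
    using that by (intro L2_diff H1_weak_pderiv[OF u1 B(1)] continuous_L2[OF _ Bm B(2)]
        smooth_continuous_on smooth_pderiv sm)
  have vL: "(\<lambda>x. u x - \<psi> k x) \<in> L2 B" for k
    by (intro L2_diff uL continuous_L2[OF _ Bm B(2)] smooth_continuous_on sm)
  have nn: "(H1_norm B (\<lambda>x. u x - \<psi> k x))\<^sup>2
      = (LINT x|?M. (u x - \<psi> k x)\<^sup>2) + (\<Sum>i\<in>Basis. LINT x|?M. (?d i k x)\<^sup>2)" for k
  proof -
    have eq: "AE x in ?M. \<forall>i\<in>Basis. weak_pderiv B i (\<lambda>x. u x - \<psi> k x) x = ?d i k x"
    proof (rule AE_finite_allI)
      fix i :: 'a assume i: "i \<in> Basis"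
      show "AE x in ?M. weak_pderiv B i (\<lambda>x. u x - \<psi> k x) x = ?d i k x"
        by (rule weak_pderiv_unique[OF has_weak_pderiv_diff[OF H1_weak_pderiv(2)[OF u1 B(1) i]
              smooth_has_weak_pderiv[OF sm B(1) i] B(1) i] B(1)])
    qed simp
    have m: "weak_pderiv B i (\<lambda>x. u x - \<psi> k x) \<in> borel_measurable ?M" if i: "i \<in> Basis" for i
    proof (rule borel_measurable_lebesgue_on_AE[OF L2_measurable[OF dL[OF i, of k]]])
      show "AE x in ?M. ?d i k x = weak_pderiv B i (\<lambda>x. u x - \<psi> k x) x"
        using eq by (rule eventually_mono) (use i in simp)
    qed (use B in auto)
    have "(LINT x|?M. (u x - \<psi> k x)\<^sup>2 + (norm (weak_grad B (\<lambda>x. u x - \<psi> k x) x))\<^sup>2)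
        = (LINT x|?M. (u x - \<psi> k x)\<^sup>2 + (\<Sum>i\<in>Basis. (?d i k x)\<^sup>2))"
      unfolding norm_weak_grad
    proof (rule integral_cong_AE)
      show "AE x in ?M. (u x - \<psi> k x)\<^sup>2 + (\<Sum>i\<in>Basis. (weak_pderiv B i (\<lambda>x. u x - \<psi> k x) x)\<^sup>2)
          = (u x - \<psi> k x)\<^sup>2 + (\<Sum>i\<in>Basis. (?d i k x)\<^sup>2)"
        using eq by (rule eventually_mono) simp
      show "(\<lambda>x. (u x - \<psi> k x)\<^sup>2 + (\<Sum>i\<in>Basis. (weak_pderiv B i (\<lambda>x. u x - \<psi> k x) x)\<^sup>2)) \<in> borel_measurable ?M"
        by (intro borel_measurable_add borel_measurable_sum borel_measurable_power L2_measurable[OF vL] m)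
      show "(\<lambda>x. (u x - \<psi> k x)\<^sup>2 + (\<Sum>i\<in>Basis. (?d i k x)\<^sup>2)) \<in> borel_measurable ?M"
        by (intro borel_measurable_add borel_measurable_sum borel_measurable_power L2_measurable[OF vL]
            L2_measurable[OF dL])
    qed
    also have "\<dots> = (LINT x|?M. (u x - \<psi> k x)\<^sup>2) + (\<Sum>i\<in>Basis. LINT x|?M. (?d i k x)\<^sup>2)"
      using dL vL by (simp add: L2_def)
    finally show ?thesis unfolding H1_norm_def
      by (subst real_sqrt_pow2) (simp_all add: sum_nonneg)
  qed
  have lim2: "(\<lambda>k. (H1_norm B (\<lambda>x. u x - \<psi> k x))\<^sup>2) \<longlonglongrightarrow> 0"
    using tendsto_power[OF lim, of 2] by simp
  show ?thesis
  proof (intro exI[of _ \<psi>] conjI ballI \<psi>)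
    show "(\<lambda>k. LINT x|?M. (u x - \<psi> k x)\<^sup>2) \<longlonglongrightarrow> 0"
      by (rule tendsto_sandwich[OF _ _ tendsto_const lim2]) (simp_all add: nn sum_nonneg)
    fix i :: 'a assume i: "i \<in> Basis"
    show "(\<lambda>k. LINT x|?M. (?d i k x)\<^sup>2) \<longlonglongrightarrow> 0"
    proof (rule tendsto_sandwich[OF _ _ tendsto_const lim2])
      show "\<forall>\<^sub>F k in sequentially. (LINT x|?M. (?d i k x)\<^sup>2) \<le> (H1_norm B (\<lambda>x. u x - \<psi> k x))\<^sup>2"
      proof (rule always_eventually, rule allI)
        fix k
        have "(LINT x|?M. (?d i k x)\<^sup>2) \<le> (\<Sum>i\<in>Basis. LINT x|?M. (?d i k x)\<^sup>2)"
          by (rule member_le_sum[OF i]) simp_all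
        moreover have "0 \<le> (LINT x|?M. (u x - \<psi> k x)\<^sup>2)" by simp
        ultimately show "(LINT x|?M. (?d i k x)\<^sup>2) \<le> (H1_norm B (\<lambda>x. u x - \<psi> k x))\<^sup>2"
          unfolding nn by linarith
      qed
    qed simp
  qed
qed

text \<open>For a test function the weak derivative of \<open>c\<close> is tested against its
  square, whose derivative brings the factor 2. Both sides are quadratic with bounded coefficients
  and so pass to the limit in L2.\<close>

lemma H10_integration_by_parts:
  assumes u: "u \<in> H10 B" and B: "open B" "bounded B" and i: "i \<in> Basis"
    and c: "c \<in> Linf B" "c' \<in> Linf B" and wd: "has_weak_pderiv B i c c'"
  shows "2 * (LINT x|lebesgue_on B. c x * (u x * weak_pderiv B i u x)) = - (LINT x|lebesgue_on B. c' x * (u x * u x))"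
proof -
  let ?M = "lebesgue_on B"
  have Bm: "B \<in> lmeasurable" using B by (simp add: lmeasurable_open)
  have u1: "u \<in> H1 B" and uL: "u \<in> L2 B" using u by (auto simp: H10_def H1_def)
  obtain \<psi> where \<psi>: "\<forall>k. test_function B (\<psi> k)" and l0: "(\<lambda>k. LINT x|?M. (u x - \<psi> k x)\<^sup>2) \<longlonglongrightarrow> 0"
    and l1: "\<forall>i\<in>Basis. (\<lambda>k. LINT x|?M. (weak_pderiv B i u x - frechet_derivative (\<psi> k) (at x) i)\<^sup>2) \<longlonglongrightarrow> 0"
    using H10_approx[OF u B] by (elim exE conjE)
  have sm: "smooth (\<psi> k)" for k using \<psi> by (blast intro: test_function_smooth)
  let ?d = "\<lambda>k x. frechet_derivative (\<psi> k) (at x) i"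
  have \<psi>L: "\<psi> k \<in> L2 B" and dL: "?d k \<in> L2 B" for k
    using sm i by (auto intro!: continuous_L2[OF _ Bm B(2)] smooth_continuous_on smooth_pderiv)
  have "(\<lambda>k. LINT x|?M. c x * (\<psi> k x * ?d k x)) \<longlonglongrightarrow> (LINT x|?M. c x * (u x * weak_pderiv B i u x))"
    using l1 i by (intro L2_integral_mult_tendsto uL \<psi>L l0 H1_weak_pderiv(1)[OF u1 B(1) i] dL c) auto
  then have l2: "(\<lambda>k. 2 * (LINT x|?M. c x * (\<psi> k x * ?d k x))) \<longlonglongrightarrow> 2 * (LINT x|?M. c x * (u x * weak_pderiv B i u x))"
    by (intro tendsto_intros)
  have eq: "2 * (LINT x|?M. c x * (\<psi> k x * ?d k x)) = - (LINT x|?M. c' x * (\<psi> k x * \<psi> k x))" for k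
  proof -
    have "test_function B (\<lambda>x. \<psi> k x * \<psi> k x)" using \<psi> sm by (simp add: test_function_mult)
    then have "(LINT x|?M. c x * frechet_derivative (\<lambda>x. \<psi> k x * \<psi> k x) (at x) i)
        = - (LINT x|?M. c' x * (\<psi> k x * \<psi> k x))"
      using wd by (simp add: has_weak_pderiv_def)
    moreover have "c x * frechet_derivative (\<lambda>x. \<psi> k x * \<psi> k x) (at x) i = 2 * (c x * (\<psi> k x * ?d k x))" for x
      by (simp add: frechet_derivative_mult[OF sm sm])
    ultimately show ?thesis by simp
  qed
  have "(\<lambda>k. - (LINT x|?M. c' x * (\<psi> k x * \<psi> k x))) \<longlonglongrightarrow> - (LINT x|?M. c' x * (u x * u x))"
    by (intro tendsto_minus L2_integral_mult_tendsto uL \<psi>L l0 c)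
  with l2 show ?thesis unfolding eq by (rule LIMSEQ_unique)
qed

section \<open>The phase field\<close>

text \<open>On one side of the boundary this is the Lipschitz bound of \<open>infdist\<close>. For
  points on different sides the segment between them meets the frontier, so the two distances, which
  add up because of the signs, total at most the length of the segment.\<close>

lemma lipschitz_signed_dist: "1-lipschitz_on UNIV (signed_dist S)"
proof (rule lipschitz_onI)
  have cross: "infdist x (frontier S) + infdist y (frontier S) \<le> dist x y"
    if "x \<in> S" "y \<notin> S" for x y
  proof -
    have "closed_segment x y \<inter> frontier S \<noteq> {}"
      by (rule connected_Int_frontier) (use that in auto)
    then obtain z where z: "z \<in> closed_segment x y" "z \<in> frontier S" by blast
    have "dist x y = dist x z + dist z y" using z(1) between[of x y z] by (simp add: between_mem_segment)
    then show ?thesis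
      using infdist_le[OF z(2), of x] infdist_le[OF z(2), of y] by (simp add: dist_commute)
  qed
  show "dist (signed_dist S x) (signed_dist S y) \<le> 1 * dist x y" for x y
    using cross[of x y] cross[of y x] infdist_triangle_abs[of x "frontier S" y]
      infdist_nonneg[of x "frontier S"] infdist_nonneg[of y "frontier S"]
    by (auto simp: signed_dist_def dist_real_def dist_commute)
qed simp

lemma lipschitz_tanh: "\<bar>tanh x - tanh y\<bar> \<le> \<bar>x - y\<bar>" for x y :: real
proof -
  have "norm (tanh x - tanh y) \<le> 1 * norm (x - y)"
  proof (rule field_differentiable_bound[of UNIV])
    show "(tanh has_field_derivative 1 - tanh z ^ 2) (at z within UNIV)" for z :: real
      by (auto intro!: derivative_eq_intros)
    show "norm (1 - tanh z ^ 2) \<le> 1" for z :: real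
      using tanh_real_bounds[of z] abs_square_le_1[of "tanh z"] by (simp add: abs_le_iff)
  qed auto
  then show ?thesis by simp
qed

text \<open>The constant is the outer factor 1/2 times the inner factor
  \<open>3 / \<epsilon>\<close>; both \<open>tanh\<close> and the signed distance contribute
  1.\<close>

lemma lipschitz_phase_field:
  assumes "\<epsilon> > 0" shows "(3 / (2 * \<epsilon>))-lipschitz_on UNIV (phase_field \<epsilon> S)"
proof (rule lipschitz_onI)
  fix x y :: 'a
  have "dist (phase_field \<epsilon> S x) (phase_field \<epsilon> S y)
      = 1 / 2 * \<bar>tanh (3 * signed_dist S x / \<epsilon>) - tanh (3 * signed_dist S y / \<epsilon>)\<bar>"
  proof -
    have "\<bar>1 / 2 * (1 - p) - 1 / 2 * (1 - q)\<bar> = 1 / 2 * \<bar>p - q\<bar>" for p q :: real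
      by (simp add: abs_if field_simps)
    then show ?thesis unfolding phase_field_def dist_real_def by blast
  qed
  also have "\<dots> \<le> 1 / 2 * \<bar>3 * signed_dist S x / \<epsilon> - 3 * signed_dist S y / \<epsilon>\<bar>"
    by (intro mult_left_mono lipschitz_tanh) simp
  also have "\<dots> = 3 / (2 * \<epsilon>) * dist (signed_dist S x) (signed_dist S y)"
  proof -
    have eq: "3 * signed_dist S x / \<epsilon> - 3 * signed_dist S y / \<epsilon> = 3 / \<epsilon> * (signed_dist S x - signed_dist S y)"
      by (simp add: algebra_simps diff_divide_distrib)
    show ?thesis unfolding eq dist_real_def abs_mult using assms by simp
  qed
  also have "\<dots> \<le> 3 / (2 * \<epsilon>) * dist x y"
    using lipschitz_onD[OF lipschitz_signed_dist, of x y S] assms by (intro mult_left_mono) auto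
  finally show "dist (phase_field \<epsilon> S x) (phase_field \<epsilon> S y) \<le> 3 / (2 * \<epsilon>) * dist x y" .
qed (use assms in simp)

lemma phase_field_bounds: "0 < phase_field \<epsilon> S x" "phase_field \<epsilon> S x < 1"
  using tanh_real_bounds[of "3 * signed_dist S x / \<epsilon>"] by (simp_all add: phase_field_def)

section \<open>Coercivity\<close>

text \<open>The integration by parts is done for each component with coefficient
  \<open>(b x \<bullet> i) * \<phi> x\<close>. Summed over \<open>i\<close>, the weak derivatives of
  these coefficients give \<open>\<phi> x * weak_div B b x + b x \<bullet> weak_grad B \<phi>
  x\<close> almost everywhere.\<close>

lemma integral_convective_term:
  fixes b :: "'a::euclidean_space \<Rightarrow> 'a"
  assumes B: "open B" "bounded B" and u: "u \<in> H10 B" and b: "\<And>i. i \<in> Basis \<Longrightarrow> (\<lambda>x. b x \<bullet> i) \<in> W1inf B"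
    and lip: "L-lipschitz_on UNIV \<phi>"
  shows "integrable (lebesgue_on B) (\<lambda>x. \<phi> x * (b x \<bullet> weak_grad B u x) * u x)"
    and "integrable (lebesgue_on B) (\<lambda>x. (\<phi> x * weak_div B b x + b x \<bullet> weak_grad B \<phi> x) * (u x * u x))"
    and "(\<lambda>x. b x \<bullet> weak_grad B \<phi> x) \<in> Linf B"
    and "2 * (LINT x|lebesgue_on B. \<phi> x * (b x \<bullet> weak_grad B u x) * u x)
      = - (LINT x|lebesgue_on B. (\<phi> x * weak_div B b x + b x \<bullet> weak_grad B \<phi> x) * (u x * u x))"
proof -
  let ?M = "lebesgue_on B"
  have Bm: "B \<in> lmeasurable" using B by (simp add: lmeasurable_open)
  then have Bs: "B \<in> sets lebesgue" by (rule fmeasurableD)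
  have u1: "u \<in> H1 B" and uL: "u \<in> L2 B" using u by (auto simp: H10_def H1_def)
  have \<phi>L: "\<phi> \<in> Linf B" using lipschitz_on_continuous_on[OF lip] Bs B(2) by (rule continuous_Linf)
  let ?b' = "\<lambda>i. weak_pderiv B i (\<lambda>y. b y \<bullet> i)" and ?\<phi>' = "\<lambda>i. weak_pderiv B i \<phi>"
  have bL: "(\<lambda>x. b x \<bullet> i) \<in> Linf B" and b'L: "?b' i \<in> Linf B"
    and bd: "has_weak_pderiv B i (\<lambda>x. b x \<bullet> i) (?b' i)" if i: "i \<in> Basis" for i
  proof -
    show "(\<lambda>x. b x \<bullet> i) \<in> Linf B" using b[OF i] by (simp add: W1inf_def)
    obtain g where g: "g \<in> Linf B" "has_weak_pderiv B i (\<lambda>x. b x \<bullet> i) g"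
      using b[OF i] i by (auto simp: W1inf_def)
    show "?b' i \<in> Linf B" using g B(1) by (intro weak_pderiv_Linf)
    show "has_weak_pderiv B i (\<lambda>x. b x \<bullet> i) (?b' i)" using g(2) by (rule weak_pderiv_works)
  qed
  have prod: "\<exists>g\<in>Linf B. (AE x in ?M. ?\<phi>' i x = g x) \<and>
      has_weak_pderiv B i (\<lambda>x. (b x \<bullet> i) * \<phi> x) (\<lambda>x. ?b' i x * \<phi> x + (b x \<bullet> i) * g x)" if i: "i \<in> Basis" for i
  proof -
    obtain g where g: "g \<in> Linf B" and pr: "\<forall>c\<in>Linf B. \<forall>c'\<in>Linf B. has_weak_pderiv B i c c' \<longrightarrow>
        has_weak_pderiv B i (\<lambda>x. c x * \<phi> x) (\<lambda>x. c' x * \<phi> x + c x * g x)"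
      using lipschitz_pderiv_product_rule[OF lip B i] by (elim bexE)
    \<comment> \<open>The product rule with the constant coefficient 1 shows that \<open>g\<close>
      is a weak derivative of \<open>\<phi>\<close>, which ties it to the representative inside
      \<open>weak_grad B \<phi>\<close>.\<close>
    have "has_weak_pderiv B i (\<lambda>_. 1) (\<lambda>_. 0)"
      using smooth_has_weak_pderiv[OF smooth_const B(1) i, of 1] by simp
    with pr[rule_format, OF Linf_const Linf_const, of 1 0] have "has_weak_pderiv B i \<phi> g" by simp
    then have "AE x in ?M. ?\<phi>' i x = g x" using B(1) by (rule weak_pderiv_unique)
    with g pr[rule_format, OF bL[OF i] b'L[OF i] bd[OF i]] show ?thesis by blast
  qed
  have "\<forall>i\<in>Basis. \<exists>g. g \<in> Linf B \<and> (AE x in ?M. ?\<phi>' i x = g x) \<and>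
      has_weak_pderiv B i (\<lambda>x. (b x \<bullet> i) * \<phi> x) (\<lambda>x. ?b' i x * \<phi> x + (b x \<bullet> i) * g x)"
    using prod by blast
  from bchoice[OF this] obtain g where g: "\<forall>i\<in>Basis. g i \<in> Linf B \<and> (AE x in ?M. ?\<phi>' i x = g i x) \<and>
      has_weak_pderiv B i (\<lambda>x. (b x \<bullet> i) * \<phi> x) (\<lambda>x. ?b' i x * \<phi> x + (b x \<bullet> i) * g i x)"
    by (elim exE)
  have \<phi>'L: "?\<phi>' i \<in> Linf B" if i: "i \<in> Basis" for i
  proof (rule Linf_AE_eq[OF _ Bs])
    show "g i \<in> Linf B" using g i by blast
    have "AE x in ?M. ?\<phi>' i x = g i x" using g i by blast
    then show "AE x in ?M. g i x = ?\<phi>' i x" by (rule eventually_mono) simp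
  qed
  show bg: "(\<lambda>x. b x \<bullet> weak_grad B \<phi> x) \<in> Linf B"
    unfolding inner_weak_grad by (intro Linf_sum Linf_mult bL \<phi>'L)
  have div: "weak_div B b \<in> Linf B"
    unfolding weak_div_def[abs_def] by (intro Linf_sum b'L)
  let ?c = "\<lambda>i x. (b x \<bullet> i) * \<phi> x" and ?c' = "\<lambda>i x. ?b' i x * \<phi> x + (b x \<bullet> i) * g i x"
  have cL: "?c i \<in> Linf B" "?c' i \<in> Linf B" if "i \<in> Basis" for i
    using that g by (auto intro!: Linf_add Linf_mult bL b'L \<phi>L)
  have uu: "integrable ?M (\<lambda>x. u x * u x)" by (intro L2_integrable_mult uL)
  have ud: "integrable ?M (\<lambda>x. u x * weak_pderiv B i u x)" if "i \<in> Basis" for i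
    by (intro L2_integrable_mult uL H1_weak_pderiv(1)[OF u1 B(1) that])
  have i1: "integrable ?M (\<lambda>x. ?c i x * (u x * weak_pderiv B i u x))" if "i \<in> Basis" for i
    using cL(1)[OF that] ud[OF that] by (rule Linf_mult_integrable)
  have i2: "integrable ?M (\<lambda>x. ?c' i x * (u x * u x))" if "i \<in> Basis" for i
    using cL(2)[OF that] uu by (rule Linf_mult_integrable)
  have eqT: "\<phi> x * (b x \<bullet> weak_grad B u x) * u x = (\<Sum>i\<in>Basis. ?c i x * (u x * weak_pderiv B i u x))" for x
    unfolding inner_weak_grad by (simp add: sum_distrib_left sum_distrib_right mult_ac)
  show "integrable ?M (\<lambda>x. \<phi> x * (b x \<bullet> weak_grad B u x) * u x)"
    unfolding eqT using i1 by (rule Bochner_Integration.integrable_sum)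
  show iU: "integrable ?M (\<lambda>x. (\<phi> x * weak_div B b x + b x \<bullet> weak_grad B \<phi> x) * (u x * u x))"
    by (intro Linf_mult_integrable uu Linf_add Linf_mult \<phi>L div bg)
  have "AE x in ?M. \<forall>i\<in>Basis. ?\<phi>' i x = g i x"
    by (rule AE_finite_allI) (use g in auto)
  then have eqU: "AE x in ?M. (\<phi> x * weak_div B b x + b x \<bullet> weak_grad B \<phi> x) * (u x * u x)
      = (\<Sum>i\<in>Basis. ?c' i x * (u x * u x))"
  proof (rule eventually_mono)
    fix x assume "\<forall>i\<in>Basis. ?\<phi>' i x = g i x"
    then have "b x \<bullet> weak_grad B \<phi> x = (\<Sum>i\<in>Basis. (b x \<bullet> i) * g i x)"
      unfolding inner_weak_grad by (intro sum.cong) auto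
    then have "\<phi> x * weak_div B b x + b x \<bullet> weak_grad B \<phi> x = (\<Sum>i\<in>Basis. ?c' i x)"
      by (simp add: weak_div_def sum_distrib_left sum.distrib mult.commute)
    then show "(\<phi> x * weak_div B b x + b x \<bullet> weak_grad B \<phi> x) * (u x * u x)
      = (\<Sum>i\<in>Basis. ?c' i x * (u x * u x))"
      by (simp only: sum_distrib_right)
  qed
  have "2 * (LINT x|?M. \<phi> x * (b x \<bullet> weak_grad B u x) * u x)
      = (\<Sum>i\<in>Basis. 2 * (LINT x|?M. ?c i x * (u x * weak_pderiv B i u x)))"
    unfolding eqT using i1 by (simp add: sum_distrib_left)
  also have "\<dots> = (\<Sum>i\<in>Basis. - (LINT x|?M. ?c' i x * (u x * u x)))"
  proof (rule sum.cong[OF refl])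
    fix i :: 'a assume i: "i \<in> Basis"
    have "has_weak_pderiv B i (?c i) (?c' i)" using g i by blast
    then show "2 * (LINT x|?M. ?c i x * (u x * weak_pderiv B i u x)) = - (LINT x|?M. ?c' i x * (u x * u x))"
      by (rule H10_integration_by_parts[OF u B i cL(1)[OF i] cL(2)[OF i]])
  qed
  also have "\<dots> = - (LINT x|?M. (\<Sum>i\<in>Basis. ?c' i x * (u x * u x)))"
    using i2 by (simp add: sum_negf)
  also have "(LINT x|?M. (\<Sum>i\<in>Basis. ?c' i x * (u x * u x)))
      = (LINT x|?M. (\<phi> x * weak_div B b x + b x \<bullet> weak_grad B \<phi> x) * (u x * u x))"
  proof (rule integral_cong_AE)
    show "(\<lambda>x. \<Sum>i\<in>Basis. ?c' i x * (u x * u x)) \<in> borel_measurable ?M"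
      by (intro borel_measurable_sum borel_measurable_integrable i2)
    show "(\<lambda>x. (\<phi> x * weak_div B b x + b x \<bullet> weak_grad B \<phi> x) * (u x * u x)) \<in> borel_measurable ?M"
      using iU by (rule borel_measurable_integrable)
    show "AE x in ?M. (\<Sum>i\<in>Basis. ?c' i x * (u x * u x))
      = (\<phi> x * weak_div B b x + b x \<bullet> weak_grad B \<phi> x) * (u x * u x)"
      using eqU by (rule eventually_mono) simp
  qed
  finally show "2 * (LINT x|?M. \<phi> x * (b x \<bullet> weak_grad B u x) * u x)
      = - (LINT x|?M. (\<phi> x * weak_div B b x + b x \<bullet> weak_grad B \<phi> x) * (u x * u x))" .
qed

text \<open>The estimate takes two facts from the phase field: a Lipschitz bound, for the
  integration by parts, and values between 0 and 1, for the signs of the weights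
  \<open>\<phi> x\<close> and \<open>1 - \<phi> x\<close>.\<close>

lemma phase_form_coercive:
  fixes b :: "'a::euclidean_space \<Rightarrow> 'a"
  assumes B: "open B" "bounded B" and \<epsilon>: "\<epsilon> > 0" and lip: "L-lipschitz_on UNIV \<phi>"
    and \<phi>: "\<And>x. 0 \<le> \<phi> x" "\<And>x. \<phi> x \<le> 1"
    and D: "D \<in> Linf B" "\<And>x. x \<in> B \<Longrightarrow> d \<le> D x"
    and b: "\<And>i. i \<in> Basis \<Longrightarrow> (\<lambda>x. b x \<bullet> i) \<in> W1inf B" and m: "m \<in> Linf B"
    and mb: "AE x in lebesgue_on B. m x - 1 / 2 * weak_div B b x \<ge> 0"
    and u: "u \<in> H10 B"
  shows "d * (phase_norm B \<epsilon> \<phi> u)\<^sup>2 \<le> phase_form B \<epsilon> \<phi> D b m u u"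
proof -
  let ?M = "lebesgue_on B"
  have Bs: "B \<in> sets lebesgue" using B(1) by simp
  have u1: "u \<in> H1 B" and uL: "u \<in> L2 B" using u by (auto simp: H10_def H1_def)
  have \<phi>L: "\<phi> \<in> Linf B" using lipschitz_on_continuous_on[OF lip] Bs B(2) by (rule continuous_Linf)
  note conv = integral_convective_term[OF B u b lip]
  define T where "T x = \<phi> x * (b x \<bullet> weak_grad B u x) * u x" for x
  define U where "U x = (\<phi> x * weak_div B b x + b x \<bullet> weak_grad B \<phi> x) * (u x * u x)" for x
  define N where "N x = \<phi> x * (norm (weak_grad B u x))\<^sup>2 + 1 / \<epsilon> ^ 3 * (1 - \<phi> x) * \<bar>u x\<bar>\<^sup>2" for x
  define P where "P x = \<phi> x * D x * (weak_grad B u x \<bullet> weak_grad B u x)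
      + D x / \<epsilon> ^ 3 * (1 - \<phi> x) * u x * u x
      + \<phi> x * (b x \<bullet> weak_grad B u x) * u x
      + max (b x \<bullet> weak_grad B \<phi> x) 0 * u x * u x
      + \<phi> x * m x * u x * u x" for x
  have T: "integrable ?M T" and U: "integrable ?M U" and TU: "2 * integral\<^sup>L ?M T = - integral\<^sup>L ?M U"
    using conv(1,2,4) by (simp_all add: T_def[abs_def] U_def[abs_def])
  have uu: "integrable ?M (\<lambda>x. u x * u x)" by (intro L2_integrable_mult uL)
  have gg: "integrable ?M (\<lambda>x. weak_grad B u x \<bullet> weak_grad B u x)"
    unfolding inner_weak_grad
    by (intro Bochner_Integration.integrable_sum)
      (simp add: weak_grad_inner L2_integrable_mult H1_weak_pderiv(1)[OF u1 B(1)])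
  have \<phi>1: "(\<lambda>x. 1 - \<phi> x) \<in> Linf B"
    using Linf_add[OF Linf_const[of 1] Linf_mult[OF Linf_const[of "-1"] \<phi>L]] by simp
  have posL: "(\<lambda>x. max (b x \<bullet> weak_grad B \<phi> x) 0) \<in> Linf B"
  proof -
    obtain C where "AE x in ?M. \<bar>b x \<bullet> weak_grad B \<phi> x\<bar> \<le> C" using conv(3) by (rule Linf_bounded)
    then have "AE x in ?M. \<bar>max (b x \<bullet> weak_grad B \<phi> x) 0\<bar> \<le> C" by (rule eventually_mono) linarith
    then show ?thesis using Linf_measurable[OF conv(3)] by (intro LinfI) auto
  qed
  have "integrable ?M (\<lambda>x. (\<phi> x * D x) * (weak_grad B u x \<bullet> weak_grad B u x)
      + (D x * (1 / \<epsilon> ^ 3) * (1 - \<phi> x)) * (u x * u x) + T x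
      + max (b x \<bullet> weak_grad B \<phi> x) 0 * (u x * u x) + (\<phi> x * m x) * (u x * u x))"
    by (intro Bochner_Integration.integrable_add Linf_mult_integrable Linf_mult Linf_const
        \<phi>L D(1) \<phi>1 posL m uu gg T)
  then have P: "integrable ?M P"
    by (simp add: P_def[abs_def] T_def mult.assoc)
  have "integrable ?M (\<lambda>x. \<phi> x * (weak_grad B u x \<bullet> weak_grad B u x)
      + (1 / \<epsilon> ^ 3 * (1 - \<phi> x)) * (u x * u x))"
    by (intro Bochner_Integration.integrable_add Linf_mult_integrable Linf_mult Linf_const \<phi>L \<phi>1 uu gg)
  moreover have "N x = \<phi> x * (weak_grad B u x \<bullet> weak_grad B u x) + (1 / \<epsilon> ^ 3 * (1 - \<phi> x)) * (u x * u x)" for x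
    unfolding N_def power2_norm_eq_inner by (simp add: power2_eq_square)
  ultimately have N: "integrable ?M N"
    by (subst Bochner_Integration.integrable_cong[OF refl]) auto
  have "d * integral\<^sup>L ?M N = (LINT x|?M. d * N x)" by simp
  \<comment> \<open>The convective integrand \<open>T\<close> has no sign. Exchanging it for
    \<open>- 1 / 2 * U x\<close> leaves the integral unchanged by \<open>TU\<close>, and only after
    this exchange does the integrand dominate \<open>d * N x\<close> pointwise.\<close>
  also have "\<dots> \<le> (LINT x|?M. P x - T x - 1 / 2 * U x)"
  proof (rule integral_mono_AE)
    show "integrable ?M (\<lambda>x. d * N x)" "integrable ?M (\<lambda>x. P x - T x - 1 / 2 * U x)"
      using N P T U by simp_all
    have "AE x in ?M. x \<in> B" by (rule AE_I2) simp
    with mb show "AE x in ?M. d * N x \<le> P x - T x - 1 / 2 * U x"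
    proof eventually_elim
      case (elim x)
      let ?G = "weak_grad B u x \<bullet> weak_grad B u x" and ?q = "b x \<bullet> weak_grad B \<phi> x"
      \<comment> \<open>Each summand is nonnegative: two carry \<open>D x - d\<close>, the third is
        half of \<open>\<bar>?q\<bar>\<close> times a square since
        \<open>max ?q 0 - 1 / 2 * ?q\<close> equals \<open>\<bar>?q\<bar> / 2\<close>, and the last
        contains the assumption on \<open>m\<close> and the divergence of \<open>b\<close>.\<close>
      have "P x - T x - 1 / 2 * U x - d * N x
          = (D x - d) * (\<phi> x * ?G) + (D x - d) * (1 / \<epsilon> ^ 3 * (1 - \<phi> x) * (u x * u x))
            + (max ?q 0 - 1 / 2 * ?q) * (u x * u x) + \<phi> x * (m x - 1 / 2 * weak_div B b x) * (u x * u x)"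
        unfolding P_def T_def U_def N_def power2_norm_eq_inner by (simp add: power2_eq_square algebra_simps add_divide_distrib diff_divide_distrib)
      moreover have "0 \<le> (D x - d) * (\<phi> x * ?G)"
        using D(2)[OF elim(2)] \<phi>(1) by (intro mult_nonneg_nonneg) auto
      moreover have "0 \<le> (D x - d) * (1 / \<epsilon> ^ 3 * (1 - \<phi> x) * (u x * u x))"
        using D(2)[OF elim(2)] \<phi>(2)[of x] \<epsilon>
        by (intro mult_nonneg_nonneg[OF _ mult_nonneg_nonneg[OF mult_nonneg_nonneg zero_le_square]]) auto
      moreover have "0 \<le> (max ?q 0 - 1 / 2 * ?q) * (u x * u x)"
        by (intro mult_nonneg_nonneg[OF _ zero_le_square]) auto
      moreover have "0 \<le> \<phi> x * (m x - 1 / 2 * weak_div B b x) * (u x * u x)"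
        using elim(1) \<phi>(1) by (intro mult_nonneg_nonneg[OF mult_nonneg_nonneg zero_le_square]) auto
      ultimately show ?case by linarith
    qed
  qed
  also have "\<dots> = integral\<^sup>L ?M P"
    using P T U TU by simp
  finally have "d * integral\<^sup>L ?M N \<le> integral\<^sup>L ?M P" .
  moreover have "(phase_norm B \<epsilon> \<phi> u)\<^sup>2 = integral\<^sup>L ?M N"
  proof -
    have "0 \<le> N x" for x
      unfolding N_def using \<phi> \<epsilon> by (intro add_nonneg_nonneg mult_nonneg_nonneg) auto
    then have "0 \<le> integral\<^sup>L ?M N" by (intro Bochner_Integration.integral_nonneg)
    then show ?thesis unfolding phase_norm_def N_def[abs_def] by simp
  qed
  moreover have "phase_form B \<epsilon> \<phi> D b m u u = integral\<^sup>L ?M P"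
    unfolding phase_form_def P_def[abs_def] ..
  ultimately show ?thesis by simp
qed

theorem theorem5p2:
  fixes \<Omega> B :: "(real ^ 'n) set"
    and \<epsilon> d :: real
    and D m :: "real ^ 'n \<Rightarrow> real"
    and b :: "real ^ 'n \<Rightarrow> real ^ 'n"
  assumes "bounded_domain \<Omega>" and "Ck_boundary 1 \<Omega>"
    and "bounded_domain B" and "\<Omega> \<subset> B"
    and "\<epsilon> > 0"
    and "D \<in> borel_measurable (lebesgue_on B)" and "bounded (D ` B)"
    and "d > 0" and "\<And>x. x \<in> B \<Longrightarrow> D x \<ge> d"
    and "\<And>i. (\<lambda>x. b x $ i) \<in> W1inf B"
    and "m \<in> Linf B"
    and "AE x in lebesgue_on B. m x - 1 / 2 * weak_div B b x \<ge> 0"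
  shows "\<exists>C>0. \<forall>u\<in>H10 B.
           phase_form B \<epsilon> (phase_field \<epsilon> \<Omega>) D b m u u
             \<ge> C * (phase_norm B \<epsilon> (phase_field \<epsilon> \<Omega>) u)\<^sup>2"
proof (intro exI[of _ d] conjI ballI)
  show "d > 0" by fact
  fix u assume u: "u \<in> H10 B"
  have B: "open B" "bounded B" using assms(3) by (simp_all add: bounded_domain_def)
  have D: "D \<in> Linf B"
  proof -
    obtain C where "\<forall>y\<in>D ` B. norm y \<le> C" using assms(7) by (auto simp: bounded_iff)
    then show ?thesis using assms(6) by (intro LinfI[of _ _ C] AE_I2) auto
  qed
  have b: "(\<lambda>x. b x \<bullet> i) \<in> W1inf B" if "i \<in> Basis" for i
  proof -
    obtain j where "i = axis j 1" using \<open>i \<in> Basis\<close> by (auto simp: Basis_vec_def)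
    then show ?thesis using assms(10)[of j] by (simp add: inner_axis)
  qed
  show "phase_form B \<epsilon> (phase_field \<epsilon> \<Omega>) D b m u u \<ge> d * (phase_norm B \<epsilon> (phase_field \<epsilon> \<Omega>) u)\<^sup>2"
    by (rule phase_form_coercive[OF B assms(5) lipschitz_phase_field[OF assms(5)] _ _ D assms(9) b
          assms(11,12) u]) (simp_all add: phase_field_bounds less_imp_le)
qed

end
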